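(* Let $f:S^n\to S^m$ be an LOMSE with nonzero singular value $\lambda$ of multiplicity $p$, and let $\rho:U\to\mathbb R$ be a smooth function on an open set $U\subset(0,+\infty)$. Then $$M_{f,\rho}:=\{(rx,\rho(r)f(x)):x\in S^n,\ r\in U\}$$ is a minimal submanifold of $\mathbb R^{n+m+2}$ if and only if, on $U$, $$\frac{\rho_{rr}}{1+\rho_r^2}+\frac{(n-p)\rho_r}{r}+\frac{p\left(\frac{\rho_r}{r}-\frac{\lambda^2\rho}{r^2}\right)}{1+\frac{\lambda^2\rho^2}{r^2}}=0.$$
   Context: $S^d\subset\mathbb R^{d+1}$ is the unit sphere with its canonical metric $g_d$. For a smooth map $f:S^n\to S^m$ and $\theta\in(0,\pi/2)$ put $M_{f,\theta}=\{(\cos\theta\cdot x,\ \sin\theta\cdot f(x)):x\in S^n\}\subset S^{n+m+1}$. The map $f$ is a Lawson-Osserman map (LOM) if there is some $\theta\in(0,\pi/2)$ such that $M_{f,\theta}$ is a minimal submanifold of $S^{n+m+1}$. An LOMSE is an LOM which is not a totally geodesic isometric embedding and such that for each $x\in S^n$ all nonzero singular values of $(f_* )_x:(T_xS^n,g_n)\to(T_{f(x)}S^m,g_m)$ are equal. It is a fact that for an LOMSE the common nonzero singular value $\lambda$ and its multiplicity $p$ are constant on $S^n$. Subscripts $r$ denote derivatives with respect to $r$. *)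

theory Defs
  imports "HOL-Analysis.Analysis"
begin

section \<open>Smoothness\<close>

(* C^k on an open set: all iterated directional derivatives up to order k exist and are continuous. *)
primrec Ck_on :: "nat \<Rightarrow> 'a::euclidean_space set \<Rightarrow> ('a \<Rightarrow> 'b::euclidean_space) \<Rightarrow> bool" where
  "Ck_on 0 W f \<longleftrightarrow> continuous_on W f"
| "Ck_on (Suc k) W f \<longleftrightarrow>
     (\<forall>x\<in>W. f differentiable (at x)) \<and> (\<forall>v. Ck_on k W (\<lambda>x. frechet_derivative f (at x) v))"

definition smooth_on :: "'a::euclidean_space set \<Rightarrow> ('a \<Rightarrow> 'b::euclidean_space) \<Rightarrow> bool" where
  "smooth_on W f \<longleftrightarrow> (\<forall>k. Ck_on k W f)"

(* A map between subsets of Euclidean spaces is smooth if it extends smoothly to a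
   neighbourhood of every point of its domain. *)
definition smooth_map ::
  "'a::euclidean_space set \<Rightarrow> 'b::euclidean_space set \<Rightarrow> ('a \<Rightarrow> 'b) \<Rightarrow> bool" where
  "smooth_map M N f \<longleftrightarrow> f ` M \<subseteq> N \<and>
     (\<forall>x\<in>M. \<exists>W g. open W \<and> x \<in> W \<and> smooth_on W g \<and> (\<forall>y\<in>M \<inter> W. g y = f y))"


section \<open>Submanifolds of Euclidean space\<close>

(* Embedded k-dimensional submanifold without boundary, by slice charts. *)
definition smooth_submanifold :: "nat \<Rightarrow> 'a::euclidean_space set \<Rightarrow> bool" where
  "smooth_submanifold k M \<longleftrightarrow>
     (\<forall>p\<in>M. \<exists>W W' \<Phi> \<Psi> (V::'a set).
        open W \<and> open W' \<and> p \<in> W \<and> homeomorphism W W' \<Phi> \<Psi> \<and>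
        smooth_on W \<Phi> \<and> smooth_on W' \<Psi> \<and>
        subspace V \<and> dim V = k \<and> \<Phi> ` (W \<inter> M) = W' \<inter> V)"

definition curve_through ::
  "'a::euclidean_space set \<Rightarrow> 'a \<Rightarrow> 'a \<Rightarrow> (real \<Rightarrow> 'a) \<Rightarrow> bool" where
  "curve_through M p v \<gamma> \<longleftrightarrow>
     (\<exists>e>0. smooth_on {-e<..<e} \<gamma> \<and> \<gamma> ` {-e<..<e} \<subseteq> M) \<and>
     \<gamma> 0 = p \<and> (\<gamma> has_vector_derivative v) (at 0)"

definition tangent_space :: "'a::euclidean_space set \<Rightarrow> 'a \<Rightarrow> 'a set" where
  "tangent_space M p = {v. \<exists>\<gamma>. curve_through M p v \<gamma>}"

(* The differential of a map f that is defined on M only. *)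
definition differential ::
  "'a::euclidean_space set \<Rightarrow> ('a \<Rightarrow> 'b::euclidean_space) \<Rightarrow> 'a \<Rightarrow> 'a \<Rightarrow> 'b" where
  "differential M f p v =
     (THE w. \<exists>\<gamma>. curve_through M p v \<gamma> \<and> ((f \<circ> \<gamma>) has_vector_derivative w) (at 0))"


section \<open>Second fundamental form and minimality\<close>

definition orth_proj :: "'a::euclidean_space set \<Rightarrow> 'a \<Rightarrow> 'a" where
  "orth_proj V x = (THE y. y \<in> V \<and> (\<forall>v\<in>V. orthogonal (x - y) v))"

(* The normal space of M at p inside the ambient submanifold S, which carries the metric
   induced from Euclidean space. S = UNIV is Euclidean space itself. *)
definition normal_space :: "'a::euclidean_space set \<Rightarrow> 'a set \<Rightarrow> 'a \<Rightarrow> 'a set" where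
  "normal_space S M p = {w \<in> tangent_space S p. \<forall>v\<in>tangent_space M p. orthogonal w v}"

(* Y is given on an open set of the surrounding Euclidean space, but only required to be
   tangent to M along M. *)
definition local_tangent_field :: "'a::euclidean_space set \<Rightarrow> 'a \<Rightarrow> ('a \<Rightarrow> 'a) \<Rightarrow> bool" where
  "local_tangent_field M p Y \<longleftrightarrow>
     (\<exists>W. open W \<and> p \<in> W \<and> smooth_on W Y \<and> (\<forall>q\<in>W \<inter> M. Y q \<in> tangent_space M q))"

(* B(u,v) is the normal part of the covariant derivative in S of a tangent field extending v,
   in direction u. The covariant derivative in S is the part of the flat derivative tangent
   to S; projecting the flat derivative to the normal space of M in S thus gives B directly. *)
definition second_fundamental_form ::
  "'a::euclidean_space set \<Rightarrow> 'a set \<Rightarrow> 'a \<Rightarrow> 'a \<Rightarrow> 'a \<Rightarrow> 'a" where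
  "second_fundamental_form S M p u v =
     (THE w. \<exists>Y. local_tangent_field M p Y \<and> Y p = v \<and>
        w = orth_proj (normal_space S M p) (frechet_derivative Y (at p) u))"

definition orthonormal_basis_of :: "'a::euclidean_space set \<Rightarrow> 'a set \<Rightarrow> bool" where
  "orthonormal_basis_of V B \<longleftrightarrow>
     B \<subseteq> V \<and> span B = V \<and> pairwise orthogonal B \<and> (\<forall>b\<in>B. norm b = 1)"

(* Trace of the second fundamental form (not divided by the dimension); it does not depend on
   the orthonormal basis. *)
definition mean_curvature :: "'a::euclidean_space set \<Rightarrow> 'a set \<Rightarrow> 'a \<Rightarrow> 'a" where
  "mean_curvature S M p =
     (\<Sum>b\<in>(SOME B. orthonormal_basis_of (tangent_space M p) B). second_fundamental_form S M p b b)"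

definition minimal_submanifold :: "'a::euclidean_space set \<Rightarrow> 'a set \<Rightarrow> bool" where
  "minimal_submanifold S M \<longleftrightarrow>
     M \<subseteq> S \<and> (\<exists>k. smooth_submanifold k M) \<and> (\<forall>p\<in>M. mean_curvature S M p = 0)"

definition totally_geodesic_isometric_embedding ::
  "'a::euclidean_space set \<Rightarrow> 'b::euclidean_space set \<Rightarrow> ('a \<Rightarrow> 'b) \<Rightarrow> bool" where
  "totally_geodesic_isometric_embedding M N f \<longleftrightarrow>
     smooth_map M N f \<and>
     (\<exists>k. smooth_submanifold k (f ` M)) \<and> (\<exists>g. homeomorphism M (f ` M) f g) \<and>
     (\<forall>x\<in>M. \<forall>u\<in>tangent_space M x. \<forall>v\<in>tangent_space M x.
        differential M f x u \<bullet> differential M f x v = u \<bullet> v) \<and>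
     (\<forall>q\<in>f ` M. \<forall>u\<in>tangent_space (f ` M) q. \<forall>v\<in>tangent_space (f ` M) q.
        second_fundamental_form N (f ` M) q u v = 0)"


section \<open>Singular values\<close>

(* For A linear on the subspace V: the eigenspace of A^* A for the eigenvalue s^2, the equation
   A^* A v = s^2 v being tested against all w in V. *)
definition singular_space ::
  "'a::euclidean_space set \<Rightarrow> ('a \<Rightarrow> 'b::euclidean_space) \<Rightarrow> real \<Rightarrow> 'a set" where
  "singular_space V A s = {v \<in> V. \<forall>w\<in>V. A v \<bullet> A w = s\<^sup>2 * (v \<bullet> w)}"

definition singular_value ::
  "'a::euclidean_space set \<Rightarrow> ('a \<Rightarrow> 'b::euclidean_space) \<Rightarrow> real \<Rightarrow> bool" where
  "singular_value V A s \<longleftrightarrow> s \<ge> 0 \<and> (\<exists>v\<in>singular_space V A s. v \<noteq> 0)"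

definition singular_multiplicity ::
  "'a::euclidean_space set \<Rightarrow> ('a \<Rightarrow> 'b::euclidean_space) \<Rightarrow> real \<Rightarrow> nat" where
  "singular_multiplicity V A s = dim (singular_space V A s)"


section \<open>Lawson-Osserman maps\<close>

(* Below, the unit sphere of 'a is S^n for DIM('a) = n + 1, that of 'b is S^m for
   DIM('b) = m + 1, and that of the product is S^(n+m+1). *)

definition LO_sphere ::
  "('a::euclidean_space \<Rightarrow> 'b::euclidean_space) \<Rightarrow> real \<Rightarrow> ('a \<times> 'b) set" where
  "LO_sphere f \<theta> = {(cos \<theta> *\<^sub>R x, sin \<theta> *\<^sub>R f x) | x. x \<in> sphere 0 1}"

definition LO_cone ::
  "('a::euclidean_space \<Rightarrow> 'b::euclidean_space) \<Rightarrow> (real \<Rightarrow> real) \<Rightarrow> real set \<Rightarrow> ('a \<times> 'b) set" where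
  "LO_cone f \<rho> U = {(r *\<^sub>R x, \<rho> r *\<^sub>R f x) | x r. x \<in> sphere 0 1 \<and> r \<in> U}"

definition LOM :: "('a::euclidean_space \<Rightarrow> 'b::euclidean_space) \<Rightarrow> bool" where
  "LOM f \<longleftrightarrow> smooth_map (sphere 0 1) (sphere 0 1) f \<and>
     (\<exists>\<theta>. 0 < \<theta> \<and> \<theta> < pi / 2 \<and> minimal_submanifold (sphere 0 1) (LO_sphere f \<theta>))"

abbreviation sphere_differential ::
  "('a::euclidean_space \<Rightarrow> 'b::euclidean_space) \<Rightarrow> 'a \<Rightarrow> 'a \<Rightarrow> 'b" where
  "sphere_differential f \<equiv> differential (sphere 0 1) f"

abbreviation sphere_tangent :: "'a::euclidean_space \<Rightarrow> 'a set" where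
  "sphere_tangent \<equiv> tangent_space (sphere 0 1)"

definition LOMSE :: "('a::euclidean_space \<Rightarrow> 'b::euclidean_space) \<Rightarrow> bool" where
  "LOMSE f \<longleftrightarrow> LOM f \<and>
     \<not> totally_geodesic_isometric_embedding (sphere 0 1) (sphere 0 1) f \<and>
     (\<forall>x\<in>sphere 0 1. \<forall>s t.
        singular_value (sphere_tangent x) (sphere_differential f x) s \<and> s \<noteq> 0 \<and>
        singular_value (sphere_tangent x) (sphere_differential f x) t \<and> t \<noteq> 0 \<longrightarrow> s = t)"

(* The nonzero singular value and its multiplicity are constant on the sphere. *)
definition nonzero_singular_value_with_multiplicity ::
  "('a::euclidean_space \<Rightarrow> 'b::euclidean_space) \<Rightarrow> real \<Rightarrow> nat \<Rightarrow> bool" where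
  "nonzero_singular_value_with_multiplicity f l p \<longleftrightarrow> l \<noteq> 0 \<and>
     (\<forall>x\<in>sphere 0 1. singular_value (sphere_tangent x) (sphere_differential f x) l \<and>
        singular_multiplicity (sphere_tangent x) (sphere_differential f x) l = p)"

end

theory Submission
  imports Defs
begin

text \<open>
  Write \<open>A\<close> and \<open>H\<close> for the first and second derivative of the 0-homogeneous extension of \<open>f\<close>. The
  cone is the graph of \<open>F(y) = \<rho>(|y|) f(y/|y|)\<close>, and a graph is minimal iff the trace of the second
  derivative of \<open>F\<close> with respect to the induced metric vanishes. At \<open>y = rx\<close> this metric is
  diagonal in an orthonormal basis made of \<open>x\<close>, the singular space \<open>E\<close> and its complement
  \<open>K = ker A\<close> in the tangent space of the sphere, so the trace is a multiple of \<open>f\<close>, depending only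
  on \<open>\<rho>\<close>, plus a weighted sum of the traces of \<open>H\<close> over \<open>E\<close> and over \<open>K\<close>.
  The point is that these two traces are known separately. Differentiating \<open>A A\<^sup>* A = \<lambda>\<^sup>2 A\<close> shows
  that \<open>H(k,k)\<close> lies in the image of \<open>A\<close> for \<open>k \<in> K\<close>, while symmetry of \<open>H\<close> makes \<open>H(h,h)\<close>
  orthogonal to that image for \<open>h \<in> E\<close>. Minimality of a single \<open>M\<^bsub>f,\<theta>\<^esub>\<close> gives one linear
  relation between the two traces modulo \<open>f\<close>, which therefore splits: the trace over \<open>K\<close> is 0 and the
  trace over \<open>E\<close> is \<open>- p \<lambda>\<^sup>2 f\<close>. Hence the whole trace is the differential expression times \<open>f\<close>.
\<close>

section \<open>Calculus of smooth maps\<close>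

text \<open>Both submanifolds are graphs of a radial profile times the 0-homogeneous extension:
  M_{f,\<theta>} lies over the sphere of radius cos \<theta> with constant profile sin \<theta>, the
  cone lies over an open set. One locale treats both bases. The definitions pick extending fields
  and bases by THE and SOME, so independence of these choices has to be settled before any curvature
  can be computed. Mean curvature is tested against vectors (a, w) with a equal to minus the adjoint
  of DF applied to w; these are normal to the graph of F over a whole neighbourhood. For
  M_{f,\<theta>} the derivative DF kills the radial direction, so a is orthogonal to x, and (a, w)
  is tangent to the ambient sphere exactly if w is orthogonal to f. That is why minimality of
  M_{f,\<theta>} says nothing about the f-component of the traces. This component comes instead from
  |f| = 1, which gives f . H(v,v) = -|A v|^2 and hence the constant -p \<lambda>^2.\<close>

abbreviation dderiv ::
  "('a::euclidean_space \<Rightarrow> 'b::euclidean_space) \<Rightarrow> 'a \<Rightarrow> 'a \<Rightarrow> 'b" where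
  "dderiv f x v \<equiv> frechet_derivative f (at x) v"

lemma dderiv_eqI: "(f has_derivative f') (at x) \<Longrightarrow> dderiv f x v = f' v"
  by (metis frechet_derivative_at)

lemma dderiv_cong:
  assumes "open W" "x \<in> W" "\<And>y. y \<in> W \<Longrightarrow> f y = g y" "f differentiable (at x)"
  shows "dderiv f x v = dderiv g x v" "g differentiable (at x)"
proof -
  have "(f has_derivative dderiv f x) (at x)"
    using assms(4) by (simp add: frechet_derivative_works)
  then have *: "(g has_derivative dderiv f x) (at x)"
    using assms(1-3) by (rule has_derivative_transform_within_open)
  then show "dderiv f x v = dderiv g x v" by (simp add: dderiv_eqI)
  show "g differentiable (at x)" using * by (rule differentiableI)
qed

lemma Ck_on_cong:
  assumes "open W" "\<And>x. x \<in> W \<Longrightarrow> f x = g x" "Ck_on k W f"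
  shows "Ck_on k W g"
  using assms(2,3)
proof (induction k arbitrary: f g)
  case 0
  then show ?case by (simp cong: continuous_on_cong)
next
  case (Suc k)
  have d: "dderiv f x v = dderiv g x v" "g differentiable (at x)" if "x \<in> W" for x v
    using dderiv_cong[OF assms(1) that, of f g] Suc.prems that by auto
  have "Ck_on k W (\<lambda>x. dderiv g x v)" for v
    by (rule Suc.IH[of "\<lambda>x. dderiv f x v"]) (use d Suc.prems in auto)
  then show ?case using d by auto
qed

text \<open>\<open>frechet_derivative\<close> is a choice operator; with an explicit derivative in
  its place, each closure property becomes an induction on the order whose step is a differentiation
  rule.\<close>

lemma Ck_on_SucI:
  assumes "open W" "\<And>x. x \<in> W \<Longrightarrow> (f has_derivative f' x) (at x)"
    "\<And>v. Ck_on k W (\<lambda>x. f' x v)"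
  shows "Ck_on (Suc k) W f"
proof -
  have "Ck_on k W (\<lambda>x. dderiv f x v)" for v
    by (rule Ck_on_cong[OF assms(1) _ assms(3)[of v]]) (use assms(2) dderiv_eqI in fastforce)
  then show ?thesis using assms(2) by (auto intro: differentiableI)
qed

text \<open>The recursion constrains the derivatives and not \<open>f\<close> itself, so lower
  regularity has to be pushed down to the base case, where differentiable maps are
  continuous.\<close>

lemma Ck_on_Suc_imp: "Ck_on (Suc k) W f \<Longrightarrow> Ck_on k W f"
proof (induction k arbitrary: f)
  case 0
  then show ?case
    by (auto intro!: differentiable_imp_continuous_on simp: differentiable_on_def differentiable_at_withinI)
next
  case (Suc k)
  show ?case
    unfolding Ck_on.simps(2)[of k]
  proof (intro conjI allI)
    show "\<forall>x\<in>W. f differentiable at x" using Suc.prems by simp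
    show "Ck_on k W (\<lambda>x. dderiv f x v)" for v
      by (rule Suc.IH) (use Suc.prems in simp)
  qed
qed

lemma Ck_on_subset: "Ck_on k W f \<Longrightarrow> V \<subseteq> W \<Longrightarrow> Ck_on k V f"
  by (induction k arbitrary: f) (auto intro: continuous_on_subset)

lemma Ck_on_local:
  assumes "\<And>x. x \<in> W \<Longrightarrow> \<exists>V. open V \<and> x \<in> V \<and> Ck_on k V f"
  shows "Ck_on k W f"
  using assms
proof (induction k arbitrary: f)
  case 0
  have "continuous (at x) f" if "x \<in> W" for x
    using 0[OF that] continuous_on_eq_continuous_at by auto
  then show ?case by (simp add: continuous_at_imp_continuous_on)
next
  case (Suc k)
  have "Ck_on k W (\<lambda>x. dderiv f x v)" for v
    by (rule Suc.IH) (use Suc.prems in force)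
  moreover have "f differentiable (at x)" if "x \<in> W" for x
    using Suc.prems[OF that] by auto
  ultimately show ?case by simp
qed

lemma Ck_on_const: "open W \<Longrightarrow> Ck_on k W (\<lambda>x. c)"
proof (induction k arbitrary: c)
  case (Suc k)
  show ?case by (rule Ck_on_SucI[where f' = "\<lambda>x v. 0"]) (use Suc in auto)
qed simp

lemma Ck_on_linear:
  assumes "open W" "bounded_linear f"
  shows "Ck_on k W f"
proof (cases k)
  case 0
  then show ?thesis using assms(2) by (simp add: linear_continuous_on)
next
  case (Suc j)
  show ?thesis unfolding Suc
    by (rule Ck_on_SucI[where f' = "\<lambda>x. f"])
      (use assms in \<open>auto intro: bounded_linear_imp_has_derivative Ck_on_const\<close>)
qed

lemma Ck_on_add:
  assumes "open W" "Ck_on k W f" "Ck_on k W g"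
  shows "Ck_on k W (\<lambda>x. f x + g x)"
  using assms(2,3)
proof (induction k arbitrary: f g)
  case (Suc k)
  show ?case
    by (rule Ck_on_SucI[where f' = "\<lambda>x v. dderiv f x v + dderiv g x v"])
      (use Suc assms(1) in \<open>auto intro!: has_derivative_add simp: frechet_derivative_works\<close>)
qed (auto intro: continuous_intros)

lemma Ck_on_sum:
  assumes "open W" "finite I" "\<And>i. i \<in> I \<Longrightarrow> Ck_on k W (f i)"
  shows "Ck_on k W (\<lambda>x. \<Sum>i\<in>I. f i x)"
  using assms(2,3)
  by (induction I rule: finite_induct) (auto intro!: Ck_on_const Ck_on_add assms(1))

text \<open>Leibniz rule for a general bilinear product, so that scalar multiples and inner products
  are both instances. Each term of the derivative keeps one undifferentiated factor, hence the
  appeal to \<open>Ck_on_Suc_imp\<close>.\<close>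

lemma Ck_on_bilinear:
  assumes "bounded_bilinear b" "open W" "Ck_on k W f" "Ck_on k W g"
  shows "Ck_on k W (\<lambda>x. b (f x) (g x))"
  using assms(3,4)
proof (induction k arbitrary: f g)
  case 0
  then show ?case using bounded_bilinear.continuous_on[OF assms(1)] by auto
next
  case (Suc k)
  have "Ck_on k W f" "Ck_on k W g"
    using Suc.prems Ck_on_Suc_imp by blast+
  then have "Ck_on k W (\<lambda>x. b (f x) (dderiv g x v) + b (dderiv f x v) (g x))" for v
    by (intro Ck_on_add assms(2) Suc.IH) (use Suc.prems in simp_all)
  moreover have "((\<lambda>x. b (f x) (g x)) has_derivative
      (\<lambda>v. b (f x) (dderiv g x v) + b (dderiv f x v) (g x))) (at x)" if "x \<in> W" for x
    by (rule bounded_bilinear.FDERIV[OF assms(1)])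
      (use Suc.prems that in \<open>auto simp: frechet_derivative_works\<close>)
  ultimately show ?case by (intro Ck_on_SucI assms(2))
qed

lemmas Ck_on_scaleR = Ck_on_bilinear[OF bounded_bilinear_scaleR]
lemmas Ck_on_inner = Ck_on_bilinear[OF bounded_bilinear_inner]

lemma linear_basis_expand:
  fixes L :: "'a::euclidean_space \<Rightarrow> 'b::real_vector"
  assumes "linear L"
  shows "L v = (\<Sum>i\<in>Basis. (v \<bullet> i) *\<^sub>R L i)"
proof -
  have "L v = L (\<Sum>i\<in>Basis. (v \<bullet> i) *\<^sub>R i)" by (simp add: euclidean_representation)
  also have "\<dots> = (\<Sum>i\<in>Basis. (v \<bullet> i) *\<^sub>R L i)"
    using assms by (simp add: linear_sum linear_cmul)
  finally show ?thesis .
qed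

text \<open>The chain rule differentiates \<open>g\<close> in the direction
  \<open>dderiv f x v\<close>, which moves with \<open>x\<close>, whereas the induction hypothesis
  speaks of fixed directions. Expanding the direction in the basis leaves sums of products to which
  it applies.\<close>

lemma Ck_on_compose:
  assumes "open W" "open V" "Ck_on k W f" "Ck_on k V g" "f ` W \<subseteq> V"
  shows "Ck_on k W (\<lambda>x. g (f x))"
  using assms(3,4)
proof (induction k arbitrary: g)
  case 0
  then show ?case using assms(5) by (auto intro: continuous_on_compose2)
next
  case (Suc k)
  have fk: "Ck_on k W f" using Suc.prems(1) by (rule Ck_on_Suc_imp)
  have df: "(f has_derivative dderiv f x) (at x)" if "x \<in> W" for x
    using Suc.prems(1) that by (simp add: frechet_derivative_works)
  have dg: "(g has_derivative dderiv g y) (at y)" if "y \<in> V" for y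
    using Suc.prems(2) that by (simp add: frechet_derivative_works)
  show ?case
  proof (rule Ck_on_SucI[where f' = "\<lambda>x v. dderiv g (f x) (dderiv f x v)"])
    show "open W" by fact
    show "((\<lambda>x. g (f x)) has_derivative (\<lambda>v. dderiv g (f x) (dderiv f x v))) (at x)"
      if "x \<in> W" for x
      by (rule has_derivative_compose[OF df[OF that] dg]) (use that assms(5) in auto)
    show "Ck_on k W (\<lambda>x. dderiv g (f x) (dderiv f x v))" for v
    proof (rule Ck_on_cong[OF assms(1)])
      show "(\<Sum>i\<in>Basis. (dderiv f x v \<bullet> i) *\<^sub>R dderiv g (f x) i)
          = dderiv g (f x) (dderiv f x v)" if "x \<in> W" for x
        by (rule linear_basis_expand[symmetric, OF has_derivative_linear[OF dg]])
          (use that assms(5) in auto)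
      show "Ck_on k W (\<lambda>x. \<Sum>i\<in>Basis. (dderiv f x v \<bullet> i) *\<^sub>R dderiv g (f x) i)"
      proof (intro Ck_on_sum Ck_on_scaleR Ck_on_inner Ck_on_const assms(1) finite_Basis)
        show "Ck_on k W (\<lambda>x. dderiv f x v)" using Suc.prems(1) by simp
        show "Ck_on k W (\<lambda>x. dderiv g (f x) i)" for i
          using Suc.IH[OF fk, of "\<lambda>y. dderiv g y i"] Suc.prems(2) by simp
      qed
    qed
  qed
qed

lemma Ck_on_Pair:
  assumes "open W" "Ck_on k W f" "Ck_on k W g"
  shows "Ck_on k W (\<lambda>x. (f x, g x))"
proof -
  have "bounded_linear (\<lambda>y::'b. (y, 0::'c))" "bounded_linear (\<lambda>y::'c. (0::'b, y))"
    by (intro bounded_linear_Pair bounded_linear_ident bounded_linear_zero)+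
  then have l: "Ck_on k UNIV (\<lambda>y::'b. (y, 0::'c))" "Ck_on k UNIV (\<lambda>y::'c. (0::'b, y))"
    by (auto intro: Ck_on_linear)
  have "Ck_on k W (\<lambda>x. (f x, 0::'c))" "Ck_on k W (\<lambda>x. (0::'b, g x))"
    using Ck_on_compose[OF assms(1) open_UNIV assms(2) l(1)]
      Ck_on_compose[OF assms(1) open_UNIV assms(3) l(2)] by simp_all
  from Ck_on_add[OF assms(1) this] show ?thesis by simp
qed

text \<open>The exponent is general because differentiation lowers it by one in the
  induction.\<close>

lemma Ck_on_powr: "Ck_on k {0<..} (\<lambda>x::real. x powr a)"
proof (induction k arbitrary: a)
  case (Suc k)
  show ?case
  proof (rule Ck_on_SucI[where f' = "\<lambda>x v. v *\<^sub>R (a *\<^sub>R x powr (a - 1))"])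
    show "((\<lambda>x. x powr a) has_derivative (\<lambda>v. v *\<^sub>R (a *\<^sub>R x powr (a - 1)))) (at x)"
      if "x \<in> {0<..}" for x
    proof -
      have "((\<lambda>x. x powr a) has_derivative (*) (a * x powr (a - 1))) (at x)"
        using has_real_derivative_powr[of x a] that by (simp add: has_field_derivative_def)
      moreover have "(*) (a * x powr (a - 1)) = (\<lambda>v. v *\<^sub>R (a *\<^sub>R x powr (a - 1)))"
        by (rule ext) simp
      ultimately show ?thesis by simp
    qed
    show "Ck_on k {0<..} (\<lambda>x. v *\<^sub>R (a *\<^sub>R x powr (a - 1)))" for v
      by (intro Ck_on_scaleR Ck_on_const Suc.IH) auto
  qed simp
qed (auto intro!: continuous_intros)

lemma smooth_on_imp_Ck: "smooth_on W f \<Longrightarrow> Ck_on k W f"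
  by (simp add: smooth_on_def)

lemma smooth_on_cong:
  assumes "open W" "\<And>x. x \<in> W \<Longrightarrow> f x = g x" "smooth_on W f"
  shows "smooth_on W g"
  using Ck_on_cong[OF assms(1,2)] assms(3) by (simp add: smooth_on_def)

lemma smooth_on_subset: "smooth_on W f \<Longrightarrow> V \<subseteq> W \<Longrightarrow> smooth_on V f"
  unfolding smooth_on_def using Ck_on_subset[of _ W f V] by simp

lemma smooth_on_local:
  assumes "\<And>x. x \<in> W \<Longrightarrow> \<exists>V. open V \<and> x \<in> V \<and> smooth_on V f"
  shows "smooth_on W f"
  unfolding smooth_on_def
proof
  show "Ck_on k W f" for k
    by (rule Ck_on_local) (use assms smooth_on_imp_Ck in metis)
qed

lemma smooth_on_const: "open W \<Longrightarrow> smooth_on W (\<lambda>x. c)"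
  by (simp add: smooth_on_def Ck_on_const)

lemma smooth_on_linear: "open W \<Longrightarrow> bounded_linear f \<Longrightarrow> smooth_on W f"
  by (simp add: smooth_on_def Ck_on_linear)

lemma smooth_on_ident: "open W \<Longrightarrow> smooth_on W (\<lambda>x. x)"
  by (simp add: smooth_on_linear)

lemma smooth_on_add:
  "open W \<Longrightarrow> smooth_on W f \<Longrightarrow> smooth_on W g \<Longrightarrow> smooth_on W (\<lambda>x. f x + g x)"
  by (simp add: smooth_on_def Ck_on_add)

lemma smooth_on_sum:
  "open W \<Longrightarrow> finite I \<Longrightarrow> (\<And>i. i \<in> I \<Longrightarrow> smooth_on W (f i)) \<Longrightarrow>
    smooth_on W (\<lambda>x. \<Sum>i\<in>I. f i x)"
  by (simp add: smooth_on_def Ck_on_sum)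

lemma smooth_on_scaleR:
  "open W \<Longrightarrow> smooth_on W f \<Longrightarrow> smooth_on W g \<Longrightarrow> smooth_on W (\<lambda>x. f x *\<^sub>R g x)"
  by (simp add: smooth_on_def Ck_on_scaleR)

lemma smooth_on_inner:
  "open W \<Longrightarrow> smooth_on W f \<Longrightarrow> smooth_on W g \<Longrightarrow> smooth_on W (\<lambda>x. f x \<bullet> g x)"
  by (simp add: smooth_on_def Ck_on_inner)

lemma smooth_on_diff:
  assumes "open W" "smooth_on W f" "smooth_on W g"
  shows "smooth_on W (\<lambda>x. f x - g x)"
  using smooth_on_add[OF assms(1,2) smooth_on_scaleR[OF assms(1) smooth_on_const assms(3), of "-1"]]
    assms(1) by simp

lemma smooth_on_Pair:
  "open W \<Longrightarrow> smooth_on W f \<Longrightarrow> smooth_on W g \<Longrightarrow> smooth_on W (\<lambda>x. (f x, g x))"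
  by (simp add: smooth_on_def Ck_on_Pair)

lemma smooth_on_compose:
  assumes "open W" "open V" "smooth_on W f" "smooth_on V g" "f ` W \<subseteq> V"
  shows "smooth_on W (\<lambda>x. g (f x))"
  unfolding smooth_on_def
proof
  show "Ck_on k W (\<lambda>x. g (f x))" for k
    by (rule Ck_on_compose[OF assms(1,2) _ _ assms(5)]) (rule assms smooth_on_imp_Ck)+
qed

lemma smooth_on_dderiv: "smooth_on W f \<Longrightarrow> smooth_on W (\<lambda>x. dderiv f x v)"
  unfolding smooth_on_def
proof
  assume "\<forall>k. Ck_on k W f"
  then have "Ck_on (Suc k) W f" for k by blast
  then show "Ck_on k W (\<lambda>x. dderiv f x v)" for k by simp
qed

lemma smooth_on_has_derivative:
  "smooth_on W f \<Longrightarrow> x \<in> W \<Longrightarrow> (f has_derivative dderiv f x) (at x)"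
  using smooth_on_imp_Ck[of W f "Suc 0"] by (simp add: frechet_derivative_works)

lemma smooth_on_imp_continuous_on: "smooth_on W f \<Longrightarrow> continuous_on W f"
  using smooth_on_imp_Ck[of W f 0] by simp

lemma linear_dderiv: "smooth_on W f \<Longrightarrow> x \<in> W \<Longrightarrow> linear (dderiv f x)"
  using has_derivative_linear smooth_on_has_derivative by blast

lemma smooth_on_powr:
  assumes "open W" "smooth_on W f" "\<And>x. x \<in> W \<Longrightarrow> f x > (0::real)"
  shows "smooth_on W (\<lambda>x. f x powr a)"
  by (rule smooth_on_compose[OF assms(1) open_greaterThan[of 0] assms(2)])
    (use assms(3) in \<open>auto simp: smooth_on_def Ck_on_powr\<close>)

text \<open>Turns \<open>norm\<close> and \<open>sgn\<close> into expressions in real powers of the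
  polynomial \<open>x \<bullet> x\<close>, which is positive off the origin; their smoothness there
  follows.\<close>

lemma inner_self_powr:
  assumes "x \<noteq> 0"
  shows "(x \<bullet> x) powr a = norm x powr (2 * a)"
proof -
  have "(x \<bullet> x) powr a = ((norm x)\<^sup>2) powr a" by (rule arg_cong[OF dot_square_norm])
  also have "(norm x)\<^sup>2 = norm x powr 2"
    by (rule powr_numeral[symmetric]) (use assms in simp)
  also have "(norm x powr 2) powr a = norm x powr (2 * a)" by (rule powr_powr)
  finally show ?thesis .
qed

lemma smooth_on_norm: "smooth_on (- {0::'a::euclidean_space}) norm"
proof (rule smooth_on_cong)
  show "smooth_on (- {0::'a}) (\<lambda>x. (x \<bullet> x) powr (1/2))"
    by (intro smooth_on_powr smooth_on_inner smooth_on_ident) auto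
qed (auto simp: inner_self_powr)

lemma smooth_on_sgn: "smooth_on (- {0::'a::euclidean_space}) sgn"
proof (rule smooth_on_cong)
  show "smooth_on (- {0::'a}) (\<lambda>x. (x \<bullet> x) powr (-1/2) *\<^sub>R x)"
    by (intro smooth_on_scaleR smooth_on_powr smooth_on_inner smooth_on_ident) auto
qed (auto simp: inner_self_powr powr_minus sgn_div_norm)

lemma smooth_on_dderiv_apply:
  assumes "open W" "open V" "smooth_on V F" "smooth_on W g" "g ` W \<subseteq> V" "smooth_on W Z"
  shows "smooth_on W (\<lambda>x. dderiv F (g x) (Z x))"
proof (rule smooth_on_cong[OF assms(1)])
  show "smooth_on W (\<lambda>x. \<Sum>i\<in>Basis. (Z x \<bullet> i) *\<^sub>R dderiv F (g x) i)"
    by (intro smooth_on_sum smooth_on_scaleR smooth_on_inner smooth_on_const assms finite_Basis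
        smooth_on_compose[OF assms(1,2,4) smooth_on_dderiv[OF assms(3)] assms(5)])
  show "(\<Sum>i\<in>Basis. (Z x \<bullet> i) *\<^sub>R dderiv F (g x) i) = dderiv F (g x) (Z x)" if "x \<in> W" for x
    by (rule linear_basis_expand[symmetric], rule linear_dderiv[OF assms(3)]) (use assms(5) that in auto)
qed

text \<open>Product rule when base point and direction both move: one term differentiates F twice
  with the direction frozen, the other moves the direction. It serves for extending fields, for
  tangent fields along curves and for differentiating the Euler relation.\<close>

lemma has_derivative_dderiv_apply:
  assumes "open V" "smooth_on V F" "(g has_derivative g') (at x)" "g x \<in> V"
    "(Z has_derivative Z') (at x)"
  shows "((\<lambda>x. dderiv F (g x) (Z x)) has_derivative
    (\<lambda>u. dderiv (\<lambda>y. dderiv F y (Z x)) (g x) (g' u) + dderiv F (g x) (Z' u))) (at x)"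
proof -
  note lin = linear_dderiv[OF assms(2)]
  have d: "((\<lambda>x. dderiv F (g x) i) has_derivative (\<lambda>u. dderiv (\<lambda>y. dderiv F y i) (g x) (g' u)))
      (at x)" for i
    using has_derivative_compose[OF assms(3)
        smooth_on_has_derivative[OF smooth_on_dderiv[OF assms(2)] assms(4), of i]] .
  have "((\<lambda>x. \<Sum>i\<in>Basis. (Z x \<bullet> i) *\<^sub>R dderiv F (g x) i) has_derivative
    (\<lambda>u. \<Sum>i\<in>Basis. (Z x \<bullet> i) *\<^sub>R dderiv (\<lambda>y. dderiv F y i) (g x) (g' u)
       + (Z' u \<bullet> i) *\<^sub>R dderiv F (g x) i)) (at x)"
    by (intro has_derivative_sum has_derivative_scaleR d has_derivative_inner_left assms(5))
  moreover have "dderiv (\<lambda>y. dderiv F y (Z x)) (g x) w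
      = (\<Sum>i\<in>Basis. (Z x \<bullet> i) *\<^sub>R dderiv (\<lambda>y. dderiv F y i) (g x) w)" for w
  proof (rule dderiv_eqI)
    have "((\<lambda>y. \<Sum>i\<in>Basis. (Z x \<bullet> i) *\<^sub>R dderiv F y i) has_derivative
       (\<lambda>w. \<Sum>i\<in>Basis. (Z x \<bullet> i) *\<^sub>R dderiv (\<lambda>y. dderiv F y i) (g x) w)) (at (g x))"
      by (intro has_derivative_sum has_derivative_scaleR_right
          smooth_on_has_derivative[OF smooth_on_dderiv[OF assms(2)] assms(4)])
    then show "((\<lambda>y. dderiv F y (Z x)) has_derivative
       (\<lambda>w. \<Sum>i\<in>Basis. (Z x \<bullet> i) *\<^sub>R dderiv (\<lambda>y. dderiv F y i) (g x) w)) (at (g x))"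
      by (rule has_derivative_transform_within_open[OF _ assms(1,4)])
        (rule linear_basis_expand[symmetric, OF lin])
  qed
  moreover have "dderiv F (g x) (Z' u) = (\<Sum>i\<in>Basis. (Z' u \<bullet> i) *\<^sub>R dderiv F (g x) i)" for u
    by (rule linear_basis_expand[OF lin[OF assms(4)]])
  ultimately have *: "((\<lambda>x. \<Sum>i\<in>Basis. (Z x \<bullet> i) *\<^sub>R dderiv F (g x) i) has_derivative
    (\<lambda>u. dderiv (\<lambda>y. dderiv F y (Z x)) (g x) (g' u) + dderiv F (g x) (Z' u))) (at x)"
    by (simp add: sum.distrib)
  have "\<forall>\<^sub>F y in at x. g y \<in> V"
    using has_derivative_continuous[OF assms(3)] assms(1,4)
    by (auto simp: continuous_within tendsto_def)
  then have "\<forall>\<^sub>F y in at x. (\<Sum>i\<in>Basis. (Z y \<bullet> i) *\<^sub>R dderiv F (g y) i) = dderiv F (g y) (Z y)"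
    by eventually_elim (rule linear_basis_expand[symmetric, OF lin])
  from has_derivative_transform_eventually[OF * this linear_basis_expand[symmetric, OF lin[OF assms(4)]]]
  show ?thesis by simp
qed

section \<open>Symmetry of the second derivative\<close>

lemma DERIV_along_line:
  fixes f :: "'a::euclidean_space \<Rightarrow> real"
  assumes "smooth_on W f" "p + a *\<^sub>R u \<in> W"
  shows "((\<lambda>a. f (p + a *\<^sub>R u)) has_real_derivative dderiv f (p + a *\<^sub>R u) u) (at a)"
proof -
  have "((\<lambda>a. p + a *\<^sub>R u) has_derivative (\<lambda>t. t *\<^sub>R u)) (at a)"
    by (auto intro!: derivative_eq_intros)
  from has_derivative_compose[OF this smooth_on_has_derivative[OF assms]]
  have "((\<lambda>a. f (p + a *\<^sub>R u)) has_derivative (\<lambda>t. dderiv f (p + a *\<^sub>R u) (t *\<^sub>R u))) (at a)" .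
  moreover have "(\<lambda>t. dderiv f (p + a *\<^sub>R u) (t *\<^sub>R u)) = (*) (dderiv f (p + a *\<^sub>R u) u)"
    by (rule ext) (simp add: linear_cmul[OF linear_dderiv[OF assms]])
  ultimately show ?thesis by (simp add: has_field_derivative_def)
qed

text \<open>Both mixed second derivatives are limits of the same second difference quotient.\<close>

lemma second_difference_mean_value:
  fixes f :: "'a::euclidean_space \<Rightarrow> real"
  assumes "smooth_on W f" "ball y d \<subseteq> W" "0 < s" "s * (norm u + norm v) < d"
  shows "\<exists>z\<in>ball y d. f (y + s *\<^sub>R u + s *\<^sub>R v) - f (y + s *\<^sub>R u) - f (y + s *\<^sub>R v) + f y
      = s * s * dderiv (\<lambda>x. dderiv f x u) z v"
proof -
  have inb: "y + a *\<^sub>R u + b *\<^sub>R v \<in> ball y d" if "0 \<le> a" "a \<le> s" "0 \<le> b" "b \<le> s" for a b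
  proof -
    have "norm (a *\<^sub>R u + b *\<^sub>R v) \<le> a * norm u + b * norm v"
      using that norm_triangle_ineq[of "a *\<^sub>R u" "b *\<^sub>R v"] by simp
    also have "\<dots> \<le> s * (norm u + norm v)"
      using that by (simp add: distrib_left add_mono mult_right_mono)
    finally have "norm (a *\<^sub>R u + b *\<^sub>R v) < d" using assms(4) by simp
    moreover have "dist y (y + a *\<^sub>R u + b *\<^sub>R v) = norm (a *\<^sub>R u + b *\<^sub>R v)"
      by (metis add.assoc add_diff_cancel_left' dist_norm norm_minus_commute)
    ultimately show ?thesis by simp
  qed
  have "((\<lambda>a. f (y + s *\<^sub>R v + a *\<^sub>R u) - f (y + a *\<^sub>R u)) has_real_derivative
      dderiv f (y + s *\<^sub>R v + a *\<^sub>R u) u - dderiv f (y + a *\<^sub>R u) u) (at a)"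
    if "0 \<le> a" "a \<le> s" for a
    using inb[of a s] inb[of a 0] that assms(2,3)
    by (intro DERIV_diff DERIV_along_line[OF assms(1)]) (auto simp: algebra_simps)
  from MVT2[OF assms(3) this] obtain a where a: "0 < a" "a < s"
    and 1: "f (y + s *\<^sub>R v + s *\<^sub>R u) - f (y + s *\<^sub>R u) - (f (y + s *\<^sub>R v) - f y)
      = s * (dderiv f (y + s *\<^sub>R v + a *\<^sub>R u) u - dderiv f (y + a *\<^sub>R u) u)"
    by auto
  have "((\<lambda>b. dderiv f (y + a *\<^sub>R u + b *\<^sub>R v) u) has_real_derivative
      dderiv (\<lambda>x. dderiv f x u) (y + a *\<^sub>R u + b *\<^sub>R v) v) (at b)"
    if "0 \<le> b" "b \<le> s" for b
    using inb[of a b] a that assms(2)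
    by (intro DERIV_along_line[OF smooth_on_dderiv[OF assms(1)]]) auto
  from MVT2[OF assms(3) this] obtain b where b: "0 < b" "b < s"
    and 2: "dderiv f (y + a *\<^sub>R u + s *\<^sub>R v) u - dderiv f (y + a *\<^sub>R u) u
      = s * dderiv (\<lambda>x. dderiv f x u) (y + a *\<^sub>R u + b *\<^sub>R v) v"
    by auto
  have e: "y + s *\<^sub>R u + s *\<^sub>R v = y + s *\<^sub>R v + s *\<^sub>R u"
    "y + a *\<^sub>R u + s *\<^sub>R v = y + s *\<^sub>R v + a *\<^sub>R u" by simp_all
  have "f (y + s *\<^sub>R u + s *\<^sub>R v) - f (y + s *\<^sub>R u) - f (y + s *\<^sub>R v) + f y
      = s * (s * dderiv (\<lambda>x. dderiv f x u) (y + a *\<^sub>R u + b *\<^sub>R v) v)"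
    unfolding 2[symmetric] e using 1 by linarith
  then show ?thesis using inb[of a b] a b by force
qed

lemma dderiv_commute_real:
  fixes f :: "'a::euclidean_space \<Rightarrow> real"
  assumes "open W" "smooth_on W f" "y \<in> W"
  shows "dderiv (\<lambda>x. dderiv f x u) y v = dderiv (\<lambda>x. dderiv f x v) y u"
proof (rule ccontr)
  define P where "P = (\<lambda>z. dderiv (\<lambda>x. dderiv f x u) z v)"
  define Q where "Q = (\<lambda>z. dderiv (\<lambda>x. dderiv f x v) z u)"
  assume "\<not> ?thesis"
  then have pos: "dist (P y) (Q y) / 2 > 0" by (simp add: P_def Q_def)
  have "continuous_on W P" "continuous_on W Q"
    unfolding P_def Q_def by (intro smooth_on_imp_continuous_on smooth_on_dderiv assms(2))+
  then have "isCont P y" "isCont Q y"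
    using assms(1,3) continuous_on_eq_continuous_at by blast+
  then obtain d1 d2 where d: "d1 > 0" "d2 > 0"
    "\<forall>z. dist z y < d1 \<longrightarrow> dist (P z) (P y) < dist (P y) (Q y) / 2"
    "\<forall>z. dist z y < d2 \<longrightarrow> dist (Q z) (Q y) < dist (P y) (Q y) / 2"
    using pos unfolding continuous_at_eps_delta by blast
  obtain d3 where d3: "d3 > 0" "ball y d3 \<subseteq> W" using assms(1,3) open_contains_ball by blast
  \<comment> \<open>On this ball \<open>P\<close> and \<open>Q\<close> each stay within half of
    their distance at \<open>y\<close>, so no value of \<open>P\<close> can equal a value of
    \<open>Q\<close>.\<close>
  define e where "e = min d1 (min d2 d3)"
  have e: "e > 0" "ball y e \<subseteq> W" using d d3 by (auto simp: e_def)
  \<comment> \<open>Small enough for the parallelogram with sides \<open>s *\<^sub>R u\<close> and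
    \<open>s *\<^sub>R v\<close> to stay in the ball; the summand 1 covers the case that both
    vectors vanish.\<close>
  define s where "s = e / (1 + norm u + norm v)"
  have n: "1 + norm u + norm v > 0" by (smt (verit) norm_ge_zero)
  have s: "s > 0" "s * (norm u + norm v) < e"
    using e n by (auto simp: s_def field_simps)
  obtain z1 where z1: "z1 \<in> ball y e"
    "f (y + s *\<^sub>R u + s *\<^sub>R v) - f (y + s *\<^sub>R u) - f (y + s *\<^sub>R v) + f y = s * s * P z1"
    using second_difference_mean_value[OF assms(2) e(2) s] unfolding P_def by blast
  obtain z2 where z2: "z2 \<in> ball y e"
    "f (y + s *\<^sub>R v + s *\<^sub>R u) - f (y + s *\<^sub>R v) - f (y + s *\<^sub>R u) + f y = s * s * Q z2"
    using second_difference_mean_value[OF assms(2) e(2) s(1), of v u] s(2)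
    unfolding Q_def by (auto simp: add.commute)
  have "y + s *\<^sub>R v + s *\<^sub>R u = y + s *\<^sub>R u + s *\<^sub>R v" by simp
  with z1(2) z2(2)[unfolded this] have "s * s * P z1 = s * s * Q z2" by linarith
  then have "P z1 = Q z2" using s(1) by simp
  moreover have "dist (P z1) (P y) < dist (P y) (Q y) / 2" "dist (Q z2) (Q y) < dist (P y) (Q y) / 2"
    using d(3)[rule_format, of z1] d(4)[rule_format, of z2] z1(1) z2(1) by (auto simp: e_def dist_commute)
  ultimately show False
    unfolding dist_real_def by argo
qed

lemma dderiv_inner_left:
  assumes "(f has_derivative f') (at x)"
  shows "dderiv (\<lambda>x. f x \<bullet> w) x v = dderiv f x v \<bullet> w"
  using dderiv_eqI[OF has_derivative_inner_left[OF assms], of w v] dderiv_eqI[OF assms, of v] by simp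

text \<open>The mean value theorem behind the real case is an equality only for real values, so the
  vector case goes through components.\<close>

lemma dderiv_commute:
  assumes "open W" "smooth_on W f" "y \<in> W"
  shows "dderiv (\<lambda>x. dderiv f x u) y v = dderiv (\<lambda>x. dderiv f x v) y u"
proof (rule euclidean_eqI)
  fix w :: 'b assume "w \<in> Basis"
  have sm: "smooth_on W (\<lambda>x. f x \<bullet> w)"
    by (intro smooth_on_inner smooth_on_const assms)
  have "dderiv (\<lambda>x. dderiv f x a) y b \<bullet> w = dderiv (\<lambda>x. dderiv (\<lambda>x. f x \<bullet> w) x a) y b" for a b
  proof -
    have "dderiv (\<lambda>x. dderiv f x a) y b \<bullet> w = dderiv (\<lambda>x. dderiv f x a \<bullet> w) y b"
      by (rule dderiv_inner_left[symmetric, OF smooth_on_has_derivative[OF smooth_on_dderiv[OF assms(2)] assms(3)]])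
    also have "\<dots> = dderiv (\<lambda>x. dderiv (\<lambda>x. f x \<bullet> w) x a) y b"
    proof (rule dderiv_cong[OF assms(1,3)])
      show "dderiv f x a \<bullet> w = dderiv (\<lambda>x. f x \<bullet> w) x a" if "x \<in> W" for x
        by (rule dderiv_inner_left[symmetric, OF smooth_on_has_derivative[OF assms(2) that]])
      show "(\<lambda>x. dderiv f x a \<bullet> w) differentiable at y"
        by (rule differentiableI, rule has_derivative_inner_left)
          (rule smooth_on_has_derivative[OF smooth_on_dderiv[OF assms(2)] assms(3)])
    qed
    finally show ?thesis .
  qed
  then show "dderiv (\<lambda>x. dderiv f x u) y v \<bullet> w = dderiv (\<lambda>x. dderiv f x v) y u \<bullet> w"
    using dderiv_commute_real[OF assms(1) sm assms(3)] by simp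
qed

section \<open>Tangent spaces and the second fundamental form\<close>

lemma has_vector_derivative_compose_has_derivative:
  assumes "(\<gamma> has_vector_derivative v) (at t)" "(F has_derivative F') (at (\<gamma> t))"
  shows "((\<lambda>t. F (\<gamma> t)) has_vector_derivative F' v) (at t)"
proof -
  have "((\<lambda>t. F (\<gamma> t)) has_derivative (\<lambda>s. F' (s *\<^sub>R v))) (at t)"
    using has_derivative_compose[OF assms(1)[unfolded has_vector_derivative_def] assms(2)] .
  then show ?thesis
    by (simp add: has_vector_derivative_def linear_cmul[OF has_derivative_linear[OF assms(2)]])
qed

lemma has_vector_derivative_Pair:
  assumes "(f has_vector_derivative u) (at t)" "(g has_vector_derivative v) (at t)"
  shows "((\<lambda>t. (f t, g t)) has_vector_derivative (u, v)) (at t)"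
  using has_derivative_Pair[OF assms[unfolded has_vector_derivative_def]]
  by (simp add: has_vector_derivative_def)

text \<open>The device by which an identity valid along a curve near time 0 is differentiated into a
  condition on velocities.\<close>

lemma vector_derivative_eq_locally:
  fixes f g :: "real \<Rightarrow> 'a::real_normed_vector"
  assumes "(f has_vector_derivative u) (at 0)" "(g has_vector_derivative v) (at 0)"
    "e > 0" "\<And>t. t \<in> {-e<..<e} \<Longrightarrow> f t = g t"
  shows "u = v"
proof -
  have "(g has_vector_derivative u) (at 0)"
    using assms(1) unfolding has_vector_derivative_def
    by (rule has_derivative_transform_within_open[of _ _ _ "UNIV" "{-e<..<e}"]) (use assms(3,4) in auto)
  then show ?thesis using assms(2) by (rule vector_derivative_unique_at)
qed

lemma curve_throughE:
  assumes "curve_through M p v \<gamma>"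
  obtains e where "e > 0" "smooth_on {-e<..<e} \<gamma>" "\<And>t. t \<in> {-e<..<e} \<Longrightarrow> \<gamma> t \<in> M"
    "\<gamma> 0 = p" "(\<gamma> has_vector_derivative v) (at 0)"
  using assms unfolding curve_through_def by blast

lemma curve_throughI:
  assumes "e > 0" "smooth_on {-e<..<e} \<gamma>" "\<And>t. t \<in> {-e<..<e} \<Longrightarrow> \<gamma> t \<in> M"
    "\<gamma> 0 = p" "(\<gamma> has_vector_derivative v) (at 0)"
  shows "curve_through M p v \<gamma>"
  using assms unfolding curve_through_def by blast

lemma tangent_space_open:
  assumes "open W" "y \<in> W"
  shows "tangent_space W y = UNIV"
proof -
  have "v \<in> tangent_space W y" for v
  proof -
    obtain d where d: "d > 0" "ball y d \<subseteq> W" using assms open_contains_ball by blast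
    define e where "e = d / (1 + norm v)"
    have n: "1 + norm v > 0" by (smt (verit) norm_ge_zero)
    have e: "e > 0" "e * norm v < d" using d n by (auto simp: e_def field_simps)
    have "curve_through W y v (\<lambda>t. y + t *\<^sub>R v)"
    proof (rule curve_throughI[OF e(1)])
      show "smooth_on {-e<..<e} (\<lambda>t. y + t *\<^sub>R v)"
        by (intro smooth_on_add smooth_on_scaleR smooth_on_const smooth_on_ident) auto
      show "y + t *\<^sub>R v \<in> W" if "t \<in> {-e<..<e}" for t
      proof -
        have "\<bar>t\<bar> * norm v \<le> e * norm v" using that by (intro mult_right_mono) auto
        then have "y + t *\<^sub>R v \<in> ball y d" using e(2) by (simp add: dist_norm)
        then show ?thesis using d(2) by blast
      qed
      show "((\<lambda>t. y + t *\<^sub>R v) has_vector_derivative v) (at 0)"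
        by (auto intro!: derivative_eq_intros)
    qed simp
    then show ?thesis unfolding tangent_space_def by blast
  qed
  then show ?thesis by blast
qed

text \<open>One inclusion differentiates |\<gamma>|^2 = c^2, the other pushes the line y + t v back
  to the sphere radially. The radius is free because the base of M_{f,\<theta>} has radius cos
  \<theta>.\<close>

lemma tangent_space_sphere:
  fixes y :: "'a::euclidean_space"
  assumes "c > 0" "y \<in> sphere 0 c"
  shows "tangent_space (sphere 0 c) y = {v. y \<bullet> v = 0}"
proof (intro equalityI subsetI)
  fix v assume "v \<in> tangent_space (sphere 0 c) y"
  then obtain \<gamma> where "curve_through (sphere 0 c) y v \<gamma>" unfolding tangent_space_def by blast
  then obtain e where e: "e > 0" "\<And>t. t \<in> {-e<..<e} \<Longrightarrow> \<gamma> t \<in> sphere 0 c"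
    "\<gamma> 0 = y" "(\<gamma> has_vector_derivative v) (at 0)" by (rule curve_throughE) blast
  have "((\<lambda>t. \<gamma> t \<bullet> \<gamma> t) has_vector_derivative \<gamma> 0 \<bullet> v + v \<bullet> \<gamma> 0) (at 0)"
    using has_derivative_inner[OF e(4)[unfolded has_vector_derivative_def]
        e(4)[unfolded has_vector_derivative_def]]
    by (simp add: has_vector_derivative_def algebra_simps)
  then have "\<gamma> 0 \<bullet> v + v \<bullet> \<gamma> 0 = 0"
    by (rule vector_derivative_eq_locally[OF _ has_vector_derivative_const[of "c\<^sup>2"] e(1)])
      (use e(2) in \<open>simp add: dot_square_norm\<close>)
  then show "v \<in> {v. y \<bullet> v = 0}" by (simp add: e(3) inner_commute)
next
  fix v assume "v \<in> {v. y \<bullet> v = 0}"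
  then have v: "y \<bullet> v = 0" by simp
  have yc: "y \<bullet> y = c\<^sup>2" using assms(2) by (simp add: dot_square_norm)
  define q where "q = (\<lambda>t. (y + t *\<^sub>R v) \<bullet> (y + t *\<^sub>R v))"
  have q: "q t = c\<^sup>2 + t\<^sup>2 * (v \<bullet> v)" for t
    by (simp add: q_def inner_add_left inner_add_right v yc inner_commute[of v y] power2_eq_square)
  have qpos: "q t > 0" for t
    using assms(1) by (simp add: q add_pos_nonneg)
  have qn: "q t = (norm (y + t *\<^sub>R v))\<^sup>2" for t by (simp only: q_def dot_square_norm)
  \<comment> \<open>The factor c / |y + t v|, written as a power of the positive polynomial
    \<open>q\<close> so that \<open>smooth_on_powr\<close> applies.\<close>
  define h where "h = (\<lambda>t. c *\<^sub>R q t powr (- (1 / 2)))"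
  have hn: "h t = c / norm (y + t *\<^sub>R v)" for t
  proof -
    have "q t powr (1 / 2) = norm (y + t *\<^sub>R v)"
      using powr_half_sqrt[of "q t"] qpos[of t] qn[of t] by simp
    moreover have "q t powr (- (1 / 2)) = inverse (q t powr (1 / 2))"
      by (rule powr_minus)
    ultimately show ?thesis by (simp only: h_def divide_inverse real_scaleR_def)
  qed
  have h0: "h 0 = 1" using assms by (simp add: hn)
  have "curve_through (sphere 0 c) y v (\<lambda>t. h t *\<^sub>R (y + t *\<^sub>R v))"
  proof (rule curve_throughI[of 1])
    show "smooth_on {-1<..<1} (\<lambda>t. h t *\<^sub>R (y + t *\<^sub>R v))"
      unfolding h_def
    proof (intro smooth_on_scaleR smooth_on_powr smooth_on_add smooth_on_const smooth_on_ident)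
      show "smooth_on {-1<..<1} q"
        unfolding q_def
        by (intro smooth_on_inner smooth_on_add smooth_on_scaleR smooth_on_const smooth_on_ident) auto
    qed (auto simp: qpos)
    show "h t *\<^sub>R (y + t *\<^sub>R v) \<in> sphere 0 c" for t
    proof -
      have "norm (y + t *\<^sub>R v) > 0" using qpos[of t] by (auto simp: qn)
      then show ?thesis using assms(1) by (simp add: hn)
    qed
    show "h 0 *\<^sub>R (y + 0 *\<^sub>R v) = y" by (simp add: h0)
    \<comment> \<open>\<open>q\<close> has no linear term because v is orthogonal to y; hence the
      rescaling does not disturb the velocity.\<close>
    have dq: "(q has_real_derivative 0) (at 0)"
      unfolding q by (auto intro!: derivative_eq_intros)
    have "(h has_real_derivative 0) (at 0)"
      unfolding h_def
      using DERIV_cmult[OF DERIV_chain2[OF has_real_derivative_powr[OF qpos] dq], of c "- (1 / 2)"]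
      by simp
    then have "((\<lambda>t. h t *\<^sub>R (y + t *\<^sub>R v)) has_vector_derivative h 0 *\<^sub>R v + 0 *\<^sub>R (y + 0 *\<^sub>R v)) (at 0)"
      by (intro has_vector_derivative_scaleR) (auto intro!: derivative_eq_intros)
    then show "((\<lambda>t. h t *\<^sub>R (y + t *\<^sub>R v)) has_vector_derivative v) (at 0)"
      by (simp add: h0)
  qed simp
  then show "v \<in> tangent_space (sphere 0 c) y" unfolding tangent_space_def by blast
qed

text \<open>Curves in the graph and curves in \<open>N\<close> correspond by projecting and lifting,
  so the statement serves an open base and a spherical base alike.\<close>

lemma tangent_space_graph:
  fixes F :: "'a::euclidean_space \<Rightarrow> 'b::euclidean_space"
  assumes "open G" "smooth_on G F" "N \<subseteq> G" "y \<in> N"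
  shows "tangent_space ((\<lambda>y. (y, F y)) ` N) (y, F y) = (\<lambda>v. (v, dderiv F y v)) ` tangent_space N y"
proof (intro equalityI subsetI)
  fix w assume "w \<in> tangent_space ((\<lambda>y. (y, F y)) ` N) (y, F y)"
  then obtain \<delta> where "curve_through ((\<lambda>y. (y, F y)) ` N) (y, F y) w \<delta>"
    unfolding tangent_space_def by blast
  then obtain e where e: "e > 0" "smooth_on {-e<..<e} \<delta>"
    "\<And>t. t \<in> {-e<..<e} \<Longrightarrow> \<delta> t \<in> (\<lambda>y. (y, F y)) ` N"
    "\<delta> 0 = (y, F y)" "(\<delta> has_vector_derivative w) (at 0)" by (rule curve_throughE) blast
  have d: "((\<lambda>t. fst (\<delta> t)) has_vector_derivative fst w) (at 0)"
    "((\<lambda>t. snd (\<delta> t)) has_vector_derivative snd w) (at 0)"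
    by (rule has_vector_derivative_compose_has_derivative[OF e(5)],
        rule bounded_linear_imp_has_derivative,
        rule bounded_linear_fst bounded_linear_snd)+
  have "curve_through N y (fst w) (\<lambda>t. fst (\<delta> t))"
  proof (rule curve_throughI[OF e(1)])
    show "smooth_on {-e<..<e} (\<lambda>t. fst (\<delta> t))"
      by (rule smooth_on_compose[OF _ open_UNIV e(2)])
        (auto intro: smooth_on_linear bounded_linear_fst)
    show "fst (\<delta> t) \<in> N" if "t \<in> {-e<..<e}" for t using e(3)[OF that] by auto
  qed (use e(4) d in auto)
  then have "fst w \<in> tangent_space N y" unfolding tangent_space_def by blast
  moreover have "snd w = dderiv F y (fst w)"
  proof (rule vector_derivative_eq_locally[OF d(2) _ e(1)])
    show "((\<lambda>t. F (fst (\<delta> t))) has_vector_derivative dderiv F y (fst w)) (at 0)"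
      by (rule has_vector_derivative_compose_has_derivative[OF d(1)])
        (use e(4) smooth_on_has_derivative[OF assms(2), of y] assms(3,4) in auto)
    show "snd (\<delta> t) = F (fst (\<delta> t))" if "t \<in> {-e<..<e}" for t using e(3)[OF that] by auto
  qed
  ultimately show "w \<in> (\<lambda>v. (v, dderiv F y v)) ` tangent_space N y"
    by (metis (mono_tags, lifting) image_eqI prod.collapse)
next
  fix w assume "w \<in> (\<lambda>v. (v, dderiv F y v)) ` tangent_space N y"
  then obtain v \<gamma> where w: "w = (v, dderiv F y v)" and "curve_through N y v \<gamma>"
    unfolding tangent_space_def by blast
  then obtain e where e: "e > 0" "smooth_on {-e<..<e} \<gamma>" "\<And>t. t \<in> {-e<..<e} \<Longrightarrow> \<gamma> t \<in> N"
    "\<gamma> 0 = y" "(\<gamma> has_vector_derivative v) (at 0)" using curve_throughE by metis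
  have "curve_through ((\<lambda>y. (y, F y)) ` N) (y, F y) w (\<lambda>t. (\<gamma> t, F (\<gamma> t)))"
  proof (rule curve_throughI[OF e(1)])
    show "smooth_on {-e<..<e} (\<lambda>t. (\<gamma> t, F (\<gamma> t)))"
      by (intro smooth_on_Pair e smooth_on_compose[OF _ assms(1) e(2) assms(2)])
        (use e(3) assms(3) in auto)
    show "((\<lambda>t. (\<gamma> t, F (\<gamma> t))) has_vector_derivative w) (at 0)"
      unfolding w
      by (rule has_vector_derivative_Pair[OF e(5) has_vector_derivative_compose_has_derivative[OF e(5)]])
        (use e(4) smooth_on_has_derivative[OF assms(2), of y] assms(3,4) in auto)
  qed (use e in auto)
  then show "w \<in> tangent_space ((\<lambda>y. (y, F y)) ` N) (y, F y)" unfolding tangent_space_def by blast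
qed

text \<open>Shows at the same time that the THE in \<open>differential\<close> is well defined: by
  the chain rule every curve with velocity v yields the derivative of the smooth extension.\<close>

lemma differential_eq_dderiv:
  assumes "open W" "smooth_on W g" "x \<in> W" "\<And>y. y \<in> M \<inter> W \<Longrightarrow> g y = f y" "v \<in> tangent_space M x"
  shows "differential M f x v = dderiv g x v"
proof -
  have *: "((f \<circ> \<gamma>) has_vector_derivative dderiv g x v) (at 0)" if c: "curve_through M x v \<gamma>" for \<gamma>
  proof -
    obtain e where e: "e > 0" "smooth_on {-e<..<e} \<gamma>" "\<And>t. t \<in> {-e<..<e} \<Longrightarrow> \<gamma> t \<in> M"
      "\<gamma> 0 = x" "(\<gamma> has_vector_derivative v) (at 0)" using c by (rule curve_throughE) blast
    have o: "open ({-e<..<e} \<inter> \<gamma> -` W)"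
      by (rule continuous_open_preimage[OF smooth_on_imp_continuous_on[OF e(2)] _ assms(1)]) simp
    have d: "((\<lambda>t. g (\<gamma> t)) has_vector_derivative dderiv g x v) (at 0)"
      by (rule has_vector_derivative_compose_has_derivative[OF e(5)])
        (use e(4) smooth_on_has_derivative[OF assms(2,3)] in auto)
    show ?thesis
      unfolding has_vector_derivative_def
      by (rule has_derivative_transform_within_open[OF d[unfolded has_vector_derivative_def] o])
        (use e(1,3,4) assms(3,4) in auto)
  qed
  obtain \<gamma> where \<gamma>: "curve_through M x v \<gamma>" using assms(5) unfolding tangent_space_def by blast
  show ?thesis
    unfolding differential_def
  proof (rule the_equality)
    show "\<exists>\<gamma>. curve_through M x v \<gamma> \<and> ((f \<circ> \<gamma>) has_vector_derivative dderiv g x v) (at 0)"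
      using \<gamma> * by blast
    show "w = dderiv g x v"
      if "\<exists>\<gamma>. curve_through M x v \<gamma> \<and> ((f \<circ> \<gamma>) has_vector_derivative w) (at 0)" for w
      using that * vector_derivative_unique_at by blast
  qed
qed

lemma orth_proj:
  fixes V :: "'a::euclidean_space set"
  assumes "subspace V"
  shows orth_proj_in: "orth_proj V x \<in> V"
    and orth_proj_inner: "v \<in> V \<Longrightarrow> orth_proj V x \<bullet> v = x \<bullet> v"
proof -
  have "\<exists>!y. y \<in> V \<and> (\<forall>v\<in>V. orthogonal (x - y) v)"
  proof (rule ex_ex1I)
    obtain y z where yz: "y \<in> span V" "\<And>w. w \<in> span V \<Longrightarrow> orthogonal z w" "x = y + z"
      using orthogonal_subspace_decomp_exists[of V x] by metis
    have "span V = V" using assms by (simp add: span_eq_iff)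
    then show "\<exists>y. y \<in> V \<and> (\<forall>v\<in>V. orthogonal (x - y) v)" using yz by (metis add_diff_cancel_left')
  next
    fix y z assume y: "y \<in> V \<and> (\<forall>v\<in>V. orthogonal (x - y) v)" and z: "z \<in> V \<and> (\<forall>v\<in>V. orthogonal (x - z) v)"
    then have "y - z \<in> V" using subspace_diff[OF assms] by blast
    then have "(x - z) \<bullet> (y - z) = 0" "(x - y) \<bullet> (y - z) = 0"
      using y z unfolding orthogonal_def by blast+
    then have "(y - z) \<bullet> (y - z) = 0" by (simp add: inner_diff_left)
    then show "y = z" by simp
  qed
  from theI'[OF this] have *: "orth_proj V x \<in> V" "\<forall>v\<in>V. orthogonal (x - orth_proj V x) v"
    unfolding orth_proj_def by blast+
  then show "orth_proj V x \<in> V" by blast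
  show "orth_proj V x \<bullet> v = x \<bullet> v" if "v \<in> V"
    using bspec[OF *(2) that] by (simp add: orthogonal_def inner_diff_left)
qed

lemma orth_proj_cong:
  assumes "subspace V" "\<And>v. v \<in> V \<Longrightarrow> x \<bullet> v = y \<bullet> v"
  shows "orth_proj V x = orth_proj V y"
proof -
  let ?d = "orth_proj V x - orth_proj V y"
  have "?d \<in> V" by (intro subspace_diff assms(1) orth_proj_in)
  then have "?d \<bullet> ?d = 0"
    using assms by (simp add: inner_diff_left orth_proj_inner)
  then show ?thesis by simp
qed

text \<open>Separates what the THE requires: some extending field, and normal components of its
  derivative that are the same for every other extension. A projection is determined by inner
  products with the subspace, so the latter suffices.\<close>

lemma second_fundamental_form_eq:
  assumes "subspace (normal_space S M p)" "local_tangent_field M p Y"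
    and "\<And>Y' \<nu>. local_tangent_field M p Y' \<Longrightarrow> Y' p = Y p \<Longrightarrow> \<nu> \<in> normal_space S M p \<Longrightarrow>
      dderiv Y' p u \<bullet> \<nu> = dderiv Y p u \<bullet> \<nu>"
  shows "second_fundamental_form S M p u (Y p) = orth_proj (normal_space S M p) (dderiv Y p u)"
  unfolding second_fundamental_form_def
proof (rule the_equality)
  show "\<exists>Y'. local_tangent_field M p Y' \<and> Y' p = Y p \<and>
      orth_proj (normal_space S M p) (dderiv Y p u) = orth_proj (normal_space S M p) (dderiv Y' p u)"
    using assms(2) by blast
  fix w assume "\<exists>Y'. local_tangent_field M p Y' \<and> Y' p = Y p \<and> w = orth_proj (normal_space S M p) (dderiv Y' p u)"
  then obtain Y' where "local_tangent_field M p Y'" "Y' p = Y p"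
    "w = orth_proj (normal_space S M p) (dderiv Y' p u)" by blast
  then show "w = orth_proj (normal_space S M p) (dderiv Y p u)"
    using orth_proj_cong[OF assms(1) assms(3)] by blast
qed

section \<open>Orthonormal bases and traces\<close>

lemma orthonormal_basis_of_exists:
  assumes "subspace V"
  shows "\<exists>B. orthonormal_basis_of V B"
  by (rule orthonormal_basis_subspace[OF assms]) (auto simp: orthonormal_basis_of_def)

lemma orthonormal_basis_of_finite: "orthonormal_basis_of V B \<Longrightarrow> finite B"
  unfolding orthonormal_basis_of_def using pairwise_orthogonal_imp_finite by blast

lemma orthonormal_basis_of_expand:
  assumes "orthonormal_basis_of V B" "v \<in> V"
  shows "(\<Sum>b\<in>B. (v \<bullet> b) *\<^sub>R b) = v"
  using assms orthonormal_basis_of_finite[OF assms(1)]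
  unfolding orthonormal_basis_of_def by (intro orthonormal_basis_expand) auto

text \<open>Expanding each b in the basis C, exchanging the sums and contracting over B. It frees
  the trace from the basis that SOME selects in \<open>mean_curvature\<close>.\<close>

lemma orthonormal_basis_trace:
  fixes q :: "'a::euclidean_space \<Rightarrow> 'a \<Rightarrow> real"
  assumes B: "orthonormal_basis_of V B" and C: "orthonormal_basis_of V C"
    and l: "\<And>v. linear (\<lambda>u. q u v)" and r: "\<And>u. linear (q u)"
  shows "(\<Sum>b\<in>B. q b b) = (\<Sum>c\<in>C. q c c)"
proof -
  have BV: "b \<in> V" if "b \<in> B" for b using B that unfolding orthonormal_basis_of_def by blast
  have CV: "c \<in> V" if "c \<in> C" for c using C that unfolding orthonormal_basis_of_def by blast
  have "q b b = (\<Sum>c\<in>C. (b \<bullet> c) * q c b)" if "b \<in> B" for b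
  proof -
    have "q b b = q (\<Sum>c\<in>C. (b \<bullet> c) *\<^sub>R c) b"
      by (simp only: orthonormal_basis_of_expand[OF C BV[OF that]])
    also have "\<dots> = (\<Sum>c\<in>C. (b \<bullet> c) * q c b)"
      by (simp add: linear_sum[OF l] linear_cmul[OF l])
    finally show ?thesis .
  qed
  then have "(\<Sum>b\<in>B. q b b) = (\<Sum>b\<in>B. \<Sum>c\<in>C. (b \<bullet> c) * q c b)" by (rule sum.cong[OF refl])
  also have "\<dots> = (\<Sum>c\<in>C. \<Sum>b\<in>B. (b \<bullet> c) * q c b)" by (rule sum.swap)
  also have "\<dots> = (\<Sum>c\<in>C. q c c)"
  proof (rule sum.cong[OF refl])
    fix c assume "c \<in> C"
    have "(\<Sum>b\<in>B. (b \<bullet> c) * q c b) = q c (\<Sum>b\<in>B. (c \<bullet> b) *\<^sub>R b)"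
      by (simp add: linear_sum[OF r] linear_cmul[OF r] inner_commute)
    then show "(\<Sum>b\<in>B. (b \<bullet> c) * q c b) = q c c"
      by (simp only: orthonormal_basis_of_expand[OF B CV[OF \<open>c \<in> C\<close>]])
  qed
  finally show ?thesis .
qed

text \<open>Meant for the graph map v \<mapsto> (v, DF v): a basis with orthogonal images
  diagonalizes the induced metric, and normalizing the images gives a basis of the tangent space.
  Injectivity allows the trace to be reindexed by the original basis.\<close>

lemma orthonormal_basis_of_image:
  assumes B: "orthonormal_basis_of V B" and L: "linear L"
    and orth: "\<And>b b'. b \<in> B \<Longrightarrow> b' \<in> B \<Longrightarrow> b \<noteq> b' \<Longrightarrow> L b \<bullet> L b' = 0"
    and nz: "\<And>b. b \<in> B \<Longrightarrow> L b \<noteq> 0"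
  defines "g \<equiv> (\<lambda>b. L b /\<^sub>R norm (L b))"
  shows "orthonormal_basis_of (L ` V) (g ` B)" "inj_on g B"
proof -
  have n: "norm (g b) = 1" if "b \<in> B" for b using nz[OF that] by (simp add: g_def)
  have o: "g b \<bullet> g b' = 0" if "b \<in> B" "b' \<in> B" "b \<noteq> b'" for b b'
    using orth[OF that] by (simp add: g_def)
  then have o': "g b \<bullet> g b' = 0" if "b \<in> B" "b' \<in> B" "g b \<noteq> g b'" for b b'
    using that by metis
  show "inj_on g B"
  proof (rule inj_onI, rule ccontr)
    fix b b' assume b: "b \<in> B" "b' \<in> B" "g b = g b'" "b \<noteq> b'"
    then have "g b \<bullet> g b = 0" using o by metis
    then show False using n[OF b(1)] by simp
  qed
  have V: "span B = V" using B unfolding orthonormal_basis_of_def by blast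
  have subV: "subspace (L ` V)"
    using subspace_span[of B] linear_subspace_image[OF L] V by blast
  have BV: "B \<subseteq> V" using V span_superset by blast
  have gV: "g ` B \<subseteq> L ` V"
    using BV subspace_scale[OF subV] by (auto simp: g_def)
  have "L b \<in> span (g ` B)" if "b \<in> B" for b
  proof -
    have "L b = norm (L b) *\<^sub>R g b" using nz[OF that] by (simp add: g_def)
    then show ?thesis using that by (metis imageI span_base span_scale)
  qed
  then have "span (L ` B) \<subseteq> span (g ` B)" by (intro span_minimal) auto
  then have "L ` V \<subseteq> span (g ` B)" using V linear_span_image[OF L, of B] by simp
  moreover have "span (g ` B) \<subseteq> L ` V" using gV subV by (rule span_minimal)
  ultimately show "orthonormal_basis_of (L ` V) (g ` B)"
    unfolding orthonormal_basis_of_def pairwise_def orthogonal_def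
    using gV n o' by auto
qed

section \<open>Mean curvature of a graph\<close>

definition second_deriv ::
  "('a::euclidean_space \<Rightarrow> 'b::euclidean_space) \<Rightarrow> 'a \<Rightarrow> 'a \<Rightarrow> 'a \<Rightarrow> 'b" where
  "second_deriv F y u v = dderiv (\<lambda>z. dderiv F z v) y u"

lemma has_derivative_second_deriv:
  "smooth_on G F \<Longrightarrow> y \<in> G \<Longrightarrow> ((\<lambda>z. dderiv F z v) has_derivative (\<lambda>u. second_deriv F y u v)) (at y)"
  unfolding second_deriv_def by (rule smooth_on_has_derivative[OF smooth_on_dderiv])

lemma second_deriv_commute:
  "open G \<Longrightarrow> smooth_on G F \<Longrightarrow> y \<in> G \<Longrightarrow> second_deriv F y u v = second_deriv F y v u"
  unfolding second_deriv_def by (rule dderiv_commute[symmetric])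

lemma linear_second_deriv:
  assumes "open G" "smooth_on G F" "y \<in> G"
  shows "linear (\<lambda>u. second_deriv F y u v)" "linear (second_deriv F y u)"
proof -
  have l: "linear (\<lambda>u. second_deriv F y u v)" for v
    using has_derivative_linear[OF has_derivative_second_deriv[OF assms(2,3)]] .
  then show "linear (\<lambda>u. second_deriv F y u v)" .
  have "second_deriv F y u = (\<lambda>v. second_deriv F y v u)"
    using second_deriv_commute[OF assms] by blast
  then show "linear (second_deriv F y u)" using l[of u] by simp
qed

text \<open>The number \<open>\<kappa>\<close> merges two kinds of base. For 0 the tangency
  condition is vacuous and all directions are tangent; for 1 the base lies in a sphere about the
  origin with tangent spaces orthogonal to the position vector.\<close>

locale smooth_graph =
  fixes F :: "'a::euclidean_space \<Rightarrow> 'b::euclidean_space" and G N :: "'a set"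
    and \<kappa> :: real and y0 :: 'a and S :: "('a \<times> 'b) set"
  assumes G: "open G" and F: "smooth_on G F" and NG: "N \<subseteq> G" and y0: "y0 \<in> N"
    and tan: "\<And>y. y \<in> N \<Longrightarrow> tangent_space N y = {v. \<kappa> * (y \<bullet> v) = 0}"
    and \<kappa>: "\<kappa> = 0 \<or> \<kappa> = 1 \<and> y0 \<noteq> 0 \<and> (\<forall>y\<in>N. y \<bullet> y = y0 \<bullet> y0)"
    and normal: "subspace (normal_space S ((\<lambda>y. (y, F y)) ` N) (y0, F y0))"
begin

definition graph :: "('a \<times> 'b) set" where "graph = (\<lambda>y. (y, F y)) ` N"

abbreviation "base \<equiv> (y0, F y0)"

lemma y0G: "y0 \<in> G" using NG y0 by blast

lemma tangent_graph:
  "y \<in> N \<Longrightarrow> tangent_space graph (y, F y) = (\<lambda>v. (v, dderiv F y v)) ` tangent_space N y"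
  unfolding graph_def by (rule tangent_space_graph[OF G F NG])

lemma tangent_graph_iff:
  "y \<in> N \<Longrightarrow> w \<in> tangent_space graph (y, F y) \<longleftrightarrow>
    \<kappa> * (y \<bullet> fst w) = 0 \<and> snd w = dderiv F y (fst w)"
  by (cases w) (auto simp: tangent_graph tan)

lemma subspace_normal: "subspace (normal_space S graph base)"
  using normal unfolding graph_def .

text \<open>For \<open>\<kappa> = 1\<close> the vector v is projected orthogonally to the position
  vector, for \<open>\<kappa> = 0\<close> it stays constant; then it is lifted to the graph. The
  denominator is the constant \<open>y0 \<bullet> y0\<close>, which equals |y|^2 along the base, so
  the field is polynomial in the base variable before lifting.\<close>

definition ext_field :: "'a \<Rightarrow> 'a \<times> 'b \<Rightarrow> 'a \<times> 'b" where
  "ext_field v = (\<lambda>q. let z = v - ((\<kappa> / (y0 \<bullet> y0)) * (v \<bullet> fst q)) *\<^sub>R fst q in (z, dderiv F (fst q) z))"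

lemma local_tangent_field_ext: "local_tangent_field graph base (ext_field v)"
  unfolding local_tangent_field_def
proof (intro exI conjI ballI)
  have o: "open (G \<times> (UNIV :: 'b set))" using G by (simp add: open_Times)
  then show "open (G \<times> (UNIV :: 'b set))" .
  show "base \<in> G \<times> UNIV" using y0G by simp
  have f: "smooth_on (G \<times> (UNIV :: 'b set)) fst"
    by (rule smooth_on_linear[OF o bounded_linear_fst])
  have z: "smooth_on (G \<times> (UNIV :: 'b set)) (\<lambda>q. v - ((\<kappa> / (y0 \<bullet> y0)) *\<^sub>R (v \<bullet> fst q)) *\<^sub>R fst q)"
    by (intro smooth_on_diff smooth_on_scaleR smooth_on_inner smooth_on_const o f)
  show "smooth_on (G \<times> UNIV) (ext_field v)"
    unfolding ext_field_def Let_def real_scaleR_def[symmetric]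
    by (intro smooth_on_Pair[OF o z] smooth_on_dderiv_apply[OF o G F f _ z]) auto
  fix q assume q: "q \<in> G \<times> UNIV \<inter> graph"
  then obtain y where y: "y \<in> N" "q = (y, F y)" unfolding graph_def by blast
  have "\<kappa> * (y \<bullet> fst (ext_field v q)) = 0"
    using \<kappa> y by (auto simp: ext_field_def Let_def inner_diff_right inner_commute)
  then show "ext_field v q \<in> tangent_space graph q"
    unfolding y(2) tangent_graph_iff[OF y(1)] by (simp add: ext_field_def Let_def)
qed

lemma ext_field_base:
  assumes "\<kappa> * (y0 \<bullet> v) = 0"
  shows "ext_field v base = (v, dderiv F y0 v)"
  using assms by (auto simp: ext_field_def inner_commute)

text \<open>The derivative is (0, D^2F(u,v)) plus the graph lift of a multiple of \<open>y0\<close>.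
  For a spherical base this lift is not tangent to the submanifold, but it is orthogonal to every
  (a, w) with a equal to minus the adjoint of DF applied to w, so only D^2F survives the
  pairing.\<close>

lemma dderiv_ext_field:
  assumes "\<kappa> * (y0 \<bullet> v) = 0"
  shows "dderiv (ext_field v) base u =
    (- ((\<kappa> / (y0 \<bullet> y0)) * (v \<bullet> fst u)) *\<^sub>R y0,
     second_deriv F y0 (fst u) v + dderiv F y0 (- ((\<kappa> / (y0 \<bullet> y0)) * (v \<bullet> fst u)) *\<^sub>R y0))"
proof -
  let ?d = "\<kappa> / (y0 \<bullet> y0)"
  define Z where "Z = (\<lambda>q::'a \<times> 'b. v - (?d * (v \<bullet> fst q)) *\<^sub>R fst q)"
  \<comment> \<open>Removes the term in which the projection coefficient stays and the position
    vector is differentiated.\<close>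
  have vy: "?d * (v \<bullet> y0) = 0" using assms by (auto simp: inner_commute)
  have f: "(fst has_derivative fst) (at base)" by (rule bounded_linear_imp_has_derivative[OF bounded_linear_fst])
  have "(Z has_derivative (\<lambda>u. 0 - ((?d * (v \<bullet> fst base)) *\<^sub>R fst u + (?d * (v \<bullet> fst u)) *\<^sub>R fst base))) (at base)"
    unfolding Z_def
    by (intro has_derivative_diff has_derivative_const has_derivative_scaleR has_derivative_mult_right
        has_derivative_inner_right f)
  then have Z: "(Z has_derivative (\<lambda>u. - (?d * (v \<bullet> fst u)) *\<^sub>R y0)) (at base)"
    by (simp only: fst_conv vy scaleR_zero_left diff_0 add_0 scaleR_minus_left)
  have Zb: "Z base = v" using vy by (simp add: Z_def)
  have g: "fst base \<in> G" using y0G by simp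
  have "((\<lambda>q. (Z q, dderiv F (fst q) (Z q))) has_derivative
      (\<lambda>u. (- (?d * (v \<bullet> fst u)) *\<^sub>R y0, dderiv (\<lambda>y. dderiv F y (Z base)) (fst base) (fst u)
        + dderiv F (fst base) (- (?d * (v \<bullet> fst u)) *\<^sub>R y0)))) (at base)"
    by (rule has_derivative_Pair[OF Z has_derivative_dderiv_apply[OF G F f g Z]])
  then have "(ext_field v has_derivative
      (\<lambda>u. (- (?d * (v \<bullet> fst u)) *\<^sub>R y0, second_deriv F y0 (fst u) v
        + dderiv F y0 (- (?d * (v \<bullet> fst u)) *\<^sub>R y0)))) (at base)"
    unfolding Zb by (simp only: second_deriv_def ext_field_def Let_def Z_def fst_conv)
  then show ?thesis by (rule dderiv_eqI)
qed

text \<open>Two tangent fields with the same value at the base point have derivatives that differ by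
  a tangent vector, because their difference along a curve is a tangent field vanishing at time 0.\<close>

lemma tangent_field_derivative_normal:
  assumes Y: "local_tangent_field graph base Y" "local_tangent_field graph base Y'" "Y' base = Y base"
    and u: "u \<in> tangent_space graph base" and \<nu>: "\<nu> \<in> normal_space S graph base"
  shows "dderiv Y' base u \<bullet> \<nu> = dderiv Y base u \<bullet> \<nu>"
proof -
  obtain W where W: "open W" "base \<in> W" "smooth_on W Y" "\<And>q. q \<in> W \<inter> graph \<Longrightarrow> Y q \<in> tangent_space graph q"
    using Y(1) unfolding local_tangent_field_def by blast
  obtain W' where W': "open W'" "base \<in> W'" "smooth_on W' Y'" "\<And>q. q \<in> W' \<inter> graph \<Longrightarrow> Y' q \<in> tangent_space graph q"
    using Y(2) unfolding local_tangent_field_def by blast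
  have dY: "(Y has_derivative dderiv Y base) (at base)" "(Y' has_derivative dderiv Y' base) (at base)"
    using W W' smooth_on_has_derivative by blast+
  define Z where "Z = (\<lambda>q. Y' q - Y q)"
  have dZ: "(Z has_derivative (\<lambda>u. dderiv Y' base u - dderiv Y base u)) (at base)"
    unfolding Z_def by (intro has_derivative_diff dY)
  let ?w = "dderiv Y' base u - dderiv Y base u"
  have Z0: "Z base = 0" using Y(3) by (simp add: Z_def)
  have Zt: "\<kappa> * (y \<bullet> fst (Z (y, F y))) = 0 \<and> snd (Z (y, F y)) = dderiv F y (fst (Z (y, F y)))"
    if "y \<in> N" "(y, F y) \<in> W \<inter> W'" for y
  proof -
    have g: "(y, F y) \<in> graph" using that unfolding graph_def by blast
    have l: "linear (dderiv F y)" using linear_dderiv[OF F] NG that by blast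
    have "Y (y, F y) \<in> tangent_space graph (y, F y)" "Y' (y, F y) \<in> tangent_space graph (y, F y)"
      using W(4) W'(4) g that by blast+
    then show ?thesis
      unfolding tangent_graph_iff[OF that(1)]
      by (auto simp: Z_def inner_diff_right linear_diff[OF l])
  qed
  obtain \<delta> where "curve_through graph base u \<delta>" using u unfolding tangent_space_def by blast
  then obtain e where e: "e > 0" "smooth_on {-e<..<e} \<delta>" "\<And>t. t \<in> {-e<..<e} \<Longrightarrow> \<delta> t \<in> graph"
    "\<delta> 0 = base" "(\<delta> has_vector_derivative u) (at 0)" using curve_throughE by metis
  have "open ({-e<..<e} \<inter> \<delta> -` (W \<inter> W'))"
    by (rule continuous_open_preimage[OF smooth_on_imp_continuous_on[OF e(2)]])
      (use W(1) W'(1) in auto)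
  moreover have "0 \<in> {-e<..<e} \<inter> \<delta> -` (W \<inter> W')" using e(1,4) W(2) W'(2) by auto
  ultimately obtain e' where e': "e' > 0" "ball 0 e' \<subseteq> {-e<..<e} \<inter> \<delta> -` (W \<inter> W')"
    using open_contains_ball by blast
  have near: "\<delta> t \<in> W \<inter> W' \<and> \<delta> t = (fst (\<delta> t), F (fst (\<delta> t))) \<and> fst (\<delta> t) \<in> N"
    if "t \<in> {-e'<..<e'}" for t
  proof -
    have t: "t \<in> {-e<..<e} \<inter> \<delta> -` (W \<inter> W')" using that by (intro subsetD[OF e'(2)]) (auto simp: dist_norm)
    then show ?thesis using e(3)[of t] unfolding graph_def by auto
  qed
  define \<alpha> where "\<alpha> = (\<lambda>t. fst (Z (\<delta> t)))"
  have dZd: "((\<lambda>t. Z (\<delta> t)) has_vector_derivative ?w) (at 0)"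
    by (rule has_vector_derivative_compose_has_derivative[OF e(5)]) (simp add: e(4) dZ)
  have d\<alpha>: "(\<alpha> has_vector_derivative fst ?w) (at 0)"
    unfolding \<alpha>_def
    by (rule has_vector_derivative_compose_has_derivative[OF dZd])
      (rule bounded_linear_imp_has_derivative[OF bounded_linear_fst])
  have d\<beta>: "((\<lambda>t. snd (Z (\<delta> t))) has_vector_derivative snd ?w) (at 0)"
    by (rule has_vector_derivative_compose_has_derivative[OF dZd])
      (rule bounded_linear_imp_has_derivative[OF bounded_linear_snd])
  have d\<gamma>: "((\<lambda>t. fst (\<delta> t)) has_vector_derivative fst u) (at 0)"
    by (rule has_vector_derivative_compose_has_derivative[OF e(5)])
      (rule bounded_linear_imp_has_derivative[OF bounded_linear_fst])
  have \<alpha>0: "\<alpha> 0 = 0" by (simp add: \<alpha>_def e(4) Z0)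
  have "((\<lambda>t. \<kappa> * (fst (\<delta> t) \<bullet> \<alpha> t)) has_vector_derivative \<kappa> * (y0 \<bullet> fst ?w)) (at 0)"
  proof -
    have "((\<lambda>t. \<kappa> * (fst (\<delta> t) \<bullet> \<alpha> t)) has_derivative
        (\<lambda>h. \<kappa> * (fst (\<delta> 0) \<bullet> (h *\<^sub>R fst ?w) + (h *\<^sub>R fst u) \<bullet> \<alpha> 0))) (at 0)"
      by (intro has_derivative_mult_right has_derivative_inner
          d\<gamma>[unfolded has_vector_derivative_def] d\<alpha>[unfolded has_vector_derivative_def])
    then show ?thesis by (simp add: has_vector_derivative_def \<alpha>0 e(4) mult.left_commute)
  qed
  then have w1: "\<kappa> * (y0 \<bullet> fst ?w) = 0"
  proof (rule vector_derivative_eq_locally[OF _ has_vector_derivative_const[of 0] e'(1)])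
    fix t assume "t \<in> {-e'<..<e'}"
    from near[OF this] have n: "\<delta> t \<in> W \<inter> W'" "\<delta> t = (fst (\<delta> t), F (fst (\<delta> t)))" "fst (\<delta> t) \<in> N" by auto
    have "\<kappa> * (fst (\<delta> t) \<bullet> fst (Z (fst (\<delta> t), F (fst (\<delta> t))))) = 0"
      using Zt[OF n(3)] n(1,2) by metis
    then show "\<kappa> * (fst (\<delta> t) \<bullet> \<alpha> t) = 0" unfolding \<alpha>_def using n(2) by metis
  qed
  have w2: "snd ?w = dderiv F y0 (fst ?w)"
  proof (rule vector_derivative_eq_locally[OF d\<beta> _ e'(1)])
    have g: "fst (\<delta> 0) \<in> G" using y0G by (simp add: e(4))
    \<comment> \<open>\<open>\<alpha>\<close> vanishes at time 0, so of the two terms of the product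
      rule only DF applied to the velocity of \<open>\<alpha>\<close> remains.\<close>
    have z: "dderiv (\<lambda>y. dderiv F y 0) y0 s = 0" for s
      using linear_0[OF linear_second_deriv(2)[OF G F y0G]] by (simp add: second_deriv_def)
    have l: "linear (dderiv F y0)" by (rule linear_dderiv[OF F y0G])
    from has_derivative_dderiv_apply[OF G F d\<gamma>[unfolded has_vector_derivative_def] g
        d\<alpha>[unfolded has_vector_derivative_def]]
    show "((\<lambda>t. dderiv F (fst (\<delta> t)) (\<alpha> t)) has_vector_derivative dderiv F y0 (fst ?w)) (at 0)"
      by (simp add: has_vector_derivative_def \<alpha>0 e(4) z linear_cmul[OF l])
    fix t assume "t \<in> {-e'<..<e'}"
    from near[OF this] have n: "\<delta> t \<in> W \<inter> W'" "\<delta> t = (fst (\<delta> t), F (fst (\<delta> t)))" "fst (\<delta> t) \<in> N" by auto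
    have "snd (Z (fst (\<delta> t), F (fst (\<delta> t)))) = dderiv F (fst (\<delta> t)) (fst (Z (fst (\<delta> t), F (fst (\<delta> t)))))"
      using Zt[OF n(3)] n(1,2) by metis
    then show "snd (Z (\<delta> t)) = dderiv F (fst (\<delta> t)) (\<alpha> t)" unfolding \<alpha>_def using n(2) by metis
  qed
  have "?w \<in> tangent_space graph base"
    using w1 w2 unfolding tangent_graph_iff[OF y0] by blast
  then have "\<nu> \<bullet> ?w = 0" using \<nu> unfolding normal_space_def orthogonal_def by blast
  then show ?thesis by (simp add: inner_diff_right inner_commute)
qed

lemma second_fundamental_form_graph:
  assumes u: "u \<in> tangent_space graph base" and v: "\<kappa> * (y0 \<bullet> v) = 0"
  shows "second_fundamental_form S graph base u (v, dderiv F y0 v)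
    = orth_proj (normal_space S graph base) (dderiv (ext_field v) base u)"
  using second_fundamental_form_eq[OF subspace_normal local_tangent_field_ext[of v], of u]
    tangent_field_derivative_normal[OF local_tangent_field_ext[of v] _ _ u]
  unfolding ext_field_base[OF v] by blast

lemma subspace_tangent: "subspace (tangent_space N y0)"
  unfolding tan[OF y0] by (auto simp: subspace_def inner_add_right distrib_left)

lemma linear_graph_map: "linear (\<lambda>v. (v, dderiv F y0 v))"
  using linear_dderiv[OF F y0G] by (auto intro!: linearI simp: linear_add linear_cmul)

text \<open>In a basis with orthogonal images under DF the induced metric is diagonal with entries 1
  + |DF b|^2, whose inverses weight the trace. The condition on \<open>a\<close> is imposed for all
  directions, also those not tangent to the base, since the derivative of the extending field
  contains a lift of \<open>y0\<close>.\<close>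

lemma mean_curvature_graph_in_normal: "mean_curvature S graph base \<in> normal_space S graph base"
  and mean_curvature_graph_inner:
  "orthonormal_basis_of (tangent_space N y0) B \<Longrightarrow>
    (\<And>b b'. b \<in> B \<Longrightarrow> b' \<in> B \<Longrightarrow> b \<noteq> b' \<Longrightarrow> dderiv F y0 b \<bullet> dderiv F y0 b' = 0) \<Longrightarrow>
    (a, w) \<in> normal_space S graph base \<Longrightarrow> (\<And>u. a \<bullet> u = - (w \<bullet> dderiv F y0 u)) \<Longrightarrow>
    mean_curvature S graph base \<bullet> (a, w) =
      (\<Sum>b\<in>B. w \<bullet> second_deriv F y0 b b / (1 + (norm (dderiv F y0 b))\<^sup>2))"
proof -
  let ?T = "tangent_space graph base" and ?V = "normal_space S graph base"
  let ?L = "\<lambda>v. (v, dderiv F y0 v)"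
  have T: "?T = ?L ` tangent_space N y0" by (rule tangent_graph[OF y0])
  have "subspace ?T" unfolding T by (rule linear_subspace_image[OF linear_graph_map subspace_tangent])
  define C where "C = (SOME B. orthonormal_basis_of ?T B)"
  have C: "orthonormal_basis_of ?T C"
    unfolding C_def by (rule someI_ex[OF orthonormal_basis_of_exists[OF \<open>subspace ?T\<close>]])
  have sff: "second_fundamental_form S graph base c c
      = orth_proj ?V (dderiv (ext_field (fst c)) base c)" if "c \<in> C" for c
  proof -
    have c: "c \<in> ?T" using C that unfolding orthonormal_basis_of_def by blast
    then have "\<kappa> * (y0 \<bullet> fst c) = 0" "c = ?L (fst c)"
      unfolding tangent_graph_iff[OF y0] by (auto simp: prod_eq_iff)
    then show ?thesis using second_fundamental_form_graph[OF c, of "fst c"] by metis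
  qed
  have mc: "mean_curvature S graph base = (\<Sum>c\<in>C. orth_proj ?V (dderiv (ext_field (fst c)) base c))"
    unfolding mean_curvature_def C_def[symmetric] by (rule sum.cong[OF refl sff])
  show "mean_curvature S graph base \<in> ?V"
    unfolding mc by (intro subspace_sum subspace_normal orth_proj_in)
  assume B: "orthonormal_basis_of (tangent_space N y0) B"
    and orth: "\<And>b b'. b \<in> B \<Longrightarrow> b' \<in> B \<Longrightarrow> b \<noteq> b' \<Longrightarrow> dderiv F y0 b \<bullet> dderiv F y0 b' = 0"
    and \<nu>: "(a, w) \<in> ?V" and aw: "\<And>u. a \<bullet> u = - (w \<bullet> dderiv F y0 u)"
  \<comment> \<open>Reading off first components extends the form to a bilinear form on the whole
    product space, as the trace lemma demands.\<close>
  define q where "q = (\<lambda>(u :: 'a \<times> 'b) (v :: 'a \<times> 'b). w \<bullet> second_deriv F y0 (fst u) (fst v))"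
  note l2 = linear_second_deriv[OF G F y0G]
  have "linear (\<lambda>u. q u v)" "linear (q v)" for v
    unfolding q_def
    by (auto intro!: linearI simp: linear_add[OF l2(1)] linear_cmul[OF l2(1)]
        linear_add[OF l2(2)] linear_cmul[OF l2(2)] inner_add_right)
  note tr = orthonormal_basis_trace[OF _ _ this]
  have "mean_curvature S graph base \<bullet> (a, w) = (\<Sum>c\<in>C. orth_proj ?V (dderiv (ext_field (fst c)) base c) \<bullet> (a, w))"
    unfolding mc by (rule inner_sum_left)
  also have "\<dots> = (\<Sum>c\<in>C. q c c)"
  proof (rule sum.cong[OF refl])
    fix c assume "c \<in> C"
    then have "c \<in> ?T" using C unfolding orthonormal_basis_of_def by blast
    then have c: "\<kappa> * (y0 \<bullet> fst c) = 0" unfolding tangent_graph_iff[OF y0] by blast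
    have "orth_proj ?V (dderiv (ext_field (fst c)) base c) \<bullet> (a, w) = dderiv (ext_field (fst c)) base c \<bullet> (a, w)"
      by (rule orth_proj_inner[OF subspace_normal \<nu>])
    also have "\<dots> = q c c"
      unfolding dderiv_ext_field[OF c] q_def
      using aw[of "- ((\<kappa> / (y0 \<bullet> y0)) * (fst c \<bullet> fst c)) *\<^sub>R y0"]
      by (simp add: inner_commute[of _ a] inner_commute[of _ w] inner_add_right)
    finally show "orth_proj ?V (dderiv (ext_field (fst c)) base c) \<bullet> (a, w) = q c c" .
  qed
  also have "\<dots> = (\<Sum>b\<in>B. w \<bullet> second_deriv F y0 b b / (1 + (norm (dderiv F y0 b))\<^sup>2))"
  proof -
    define g where "g = (\<lambda>b. ?L b /\<^sub>R norm (?L b))"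
    have n1: "norm b = 1" if "b \<in> B" for b using B that unfolding orthonormal_basis_of_def by blast
    have bo: "b \<bullet> b' = 0" if "b \<in> B" "b' \<in> B" "b \<noteq> b'" for b b'
      using B that unfolding orthonormal_basis_of_def pairwise_def orthogonal_def by blast
    have nz: "?L b \<noteq> 0" if "b \<in> B" for b using n1[OF that] by (auto simp: prod_eq_iff)
    have o: "?L b \<bullet> ?L b' = 0" if "b \<in> B" "b' \<in> B" "b \<noteq> b'" for b b'
      using bo[OF that] orth[OF that] by simp
    from orthonormal_basis_of_image[OF B linear_graph_map o nz]
    have gB: "orthonormal_basis_of ?T (g ` B)" and inj: "inj_on g B"
      unfolding g_def T by blast+
    have "(\<Sum>c\<in>C. q c c) = (\<Sum>c\<in>g ` B. q c c)" by (rule tr[OF C gB])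
    also have "\<dots> = (\<Sum>b\<in>B. q (g b) (g b))" using inj by (simp add: sum.reindex)
    also have "\<dots> = (\<Sum>b\<in>B. w \<bullet> second_deriv F y0 b b / (1 + (norm (dderiv F y0 b))\<^sup>2))"
    proof (rule sum.cong[OF refl])
      fix b assume "b \<in> B"
      have "(norm (?L b))\<^sup>2 = 1 + (norm (dderiv F y0 b))\<^sup>2"
        using n1[OF \<open>b \<in> B\<close>] by (simp add: norm_Pair)
      moreover have "q (g b) (g b) = w \<bullet> second_deriv F y0 b b / (norm (?L b))\<^sup>2"
        by (simp add: q_def g_def linear_cmul[OF l2(1)] linear_cmul[OF l2(2)] power2_eq_square divide_inverse)
      ultimately show "q (g b) (g b) = w \<bullet> second_deriv F y0 b b / (1 + (norm (dderiv F y0 b))\<^sup>2)"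
        by simp
    qed
    finally show ?thesis .
  qed
  finally show "mean_curvature S graph base \<bullet> (a, w) =
      (\<Sum>b\<in>B. w \<bullet> second_deriv F y0 b b / (1 + (norm (dderiv F y0 b))\<^sup>2))" .
qed

end

section \<open>Homogeneous maps and radial graphs\<close>

locale zero_homogeneous =
  fixes g :: "'a::euclidean_space \<Rightarrow> 'b::euclidean_space"
  assumes smooth: "smooth_on (- {0}) g"
    and hom: "\<And>c y. c > 0 \<Longrightarrow> g (c *\<^sub>R y) = g y"
begin

lemma deriv_at: "y \<noteq> 0 \<Longrightarrow> (g has_derivative dderiv g y) (at y)"
  by (rule smooth_on_has_derivative[OF smooth]) simp

lemma linear_deriv: "y \<noteq> 0 \<Longrightarrow> linear (dderiv g y)"
  by (rule linear_dderiv[OF smooth]) simp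

lemma linear_second:
  assumes "y \<noteq> 0"
  shows "linear (\<lambda>u. second_deriv g y u v)" "linear (second_deriv g y u)"
  using linear_second_deriv[of "- {0}" g y] smooth assms by auto

lemma second_commute: "y \<noteq> 0 \<Longrightarrow> second_deriv g y u v = second_deriv g y v u"
  by (rule second_deriv_commute[of "- {0}"]) (use smooth in auto)

lemma second_at: "y \<noteq> 0 \<Longrightarrow> ((\<lambda>z. dderiv g z v) has_derivative (\<lambda>u. second_deriv g y u v)) (at y)"
  by (rule has_derivative_second_deriv[OF smooth]) simp

lemma deriv_radial:
  assumes "y \<noteq> 0"
  shows "dderiv g y y = 0"
proof -
  have "((\<lambda>t. y + t *\<^sub>R y) has_vector_derivative y) (at 0)"
    by (auto intro!: derivative_eq_intros)
  moreover have "(g has_derivative dderiv g y) (at (y + 0 *\<^sub>R y))"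
    using deriv_at[OF assms] by simp
  ultimately have "((\<lambda>t. g (y + t *\<^sub>R y)) has_vector_derivative dderiv g y y) (at 0)"
    by (rule has_vector_derivative_compose_has_derivative)
  then show ?thesis
  proof (rule vector_derivative_eq_locally[OF _ has_vector_derivative_const[of "g y"], where e = 1])
    show "g (y + t *\<^sub>R y) = g y" if "t \<in> {-1<..<1}" for t
      using hom[of "1 + t" y] that by (simp add: scaleR_add_left)
  qed simp
qed

text \<open>Differentiating g(z / c) = g(z) at c y: the derivative is homogeneous of degree -1, and
  \<open>second_scale\<close> repeats this for degree -2.\<close>

lemma deriv_scale:
  assumes "y \<noteq> 0" "c > 0"
  shows "dderiv g (c *\<^sub>R y) v = (1 / c) *\<^sub>R dderiv g y v"
proof -
  have eq: "(\<lambda>z. g ((1 / c) *\<^sub>R z)) = g" using hom[of "1 / c"] assms(2) by auto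
  have "((\<lambda>z. (1 / c) *\<^sub>R z) has_derivative (\<lambda>v. (1 / c) *\<^sub>R v)) (at (c *\<^sub>R y))"
    by (intro has_derivative_scaleR_right has_derivative_ident)
  moreover have "(g has_derivative dderiv g y) (at ((1 / c) *\<^sub>R (c *\<^sub>R y)))"
    using deriv_at[OF assms(1)] assms(2) by simp
  ultimately have "((\<lambda>z. g ((1 / c) *\<^sub>R z)) has_derivative (\<lambda>v. dderiv g y ((1 / c) *\<^sub>R v))) (at (c *\<^sub>R y))"
    by (rule has_derivative_compose)
  then have "(g has_derivative (\<lambda>v. dderiv g y ((1 / c) *\<^sub>R v))) (at (c *\<^sub>R y))" unfolding eq .
  then have "dderiv g (c *\<^sub>R y) v = dderiv g y ((1 / c) *\<^sub>R v)" by (rule dderiv_eqI)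
  then show ?thesis by (simp only: linear_cmul[OF linear_deriv[OF assms(1)]])
qed

lemma second_scale:
  assumes "y \<noteq> 0" "c > 0"
  shows "second_deriv g (c *\<^sub>R y) u v = (1 / c\<^sup>2) *\<^sub>R second_deriv g y u v"
proof -
  have "((\<lambda>z. (1 / c) *\<^sub>R z) has_derivative (\<lambda>v. (1 / c) *\<^sub>R v)) (at (c *\<^sub>R y))"
    by (intro has_derivative_scaleR_right has_derivative_ident)
  moreover have "((\<lambda>z. dderiv g z v) has_derivative (\<lambda>u. second_deriv g y u v)) (at ((1 / c) *\<^sub>R (c *\<^sub>R y)))"
    using second_at[OF assms(1)] assms(2) by simp
  ultimately have "((\<lambda>z. dderiv g ((1 / c) *\<^sub>R z) v) has_derivative
      (\<lambda>u. second_deriv g y ((1 / c) *\<^sub>R u) v)) (at (c *\<^sub>R y))"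
    by (rule has_derivative_compose)
  from has_derivative_scaleR_right[OF this, of "1 / c"]
  have "((\<lambda>z. dderiv g z v) has_derivative (\<lambda>u. (1 / c) *\<^sub>R second_deriv g y ((1 / c) *\<^sub>R u) v)) (at (c *\<^sub>R y))"
  proof (rule has_derivative_transform_within_open[of _ _ _ _ "- {0}"])
    show "(1 / c) *\<^sub>R dderiv g ((1 / c) *\<^sub>R z) v = dderiv g z v" if "z \<in> - {0}" for z
      using deriv_scale[of z "1 / c" v] that assms(2) by simp
  qed (use assms in auto)
  then have "second_deriv g (c *\<^sub>R y) u v = (1 / c) *\<^sub>R second_deriv g y ((1 / c) *\<^sub>R u) v"
    unfolding second_deriv_def[of g "c *\<^sub>R y"] by (rule dderiv_eqI)
  then show ?thesis
    by (simp only: linear_cmul[OF linear_second(1)[OF assms(1)]] scaleR_scaleR power2_eq_square) simp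
qed

text \<open>Differentiate the Euler relation Dg(z) z = 0 in direction y; the term Dg(y) y vanishes
  again.\<close>

lemma second_radial:
  assumes "y \<noteq> 0"
  shows "second_deriv g y y y = 0"
proof -
  have y: "y \<in> - {0}" using assms by simp
  have "((\<lambda>z. dderiv g z z) has_derivative (\<lambda>u. dderiv (\<lambda>z. dderiv g z y) y u + dderiv g y u)) (at y)"
    by (rule has_derivative_dderiv_apply[OF _ smooth has_derivative_ident y has_derivative_ident]) auto
  then have "((\<lambda>z. 0) has_derivative (\<lambda>u. dderiv (\<lambda>z. dderiv g z y) y u + dderiv g y u)) (at y)"
    by (rule has_derivative_transform_within_open[of _ _ _ _ "- {0}"])
      (use assms deriv_radial in auto)
  then have "(\<lambda>u. dderiv (\<lambda>z. dderiv g z y) y u + dderiv g y u) = (\<lambda>u. 0)"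
    by (rule has_derivative_unique) (rule has_derivative_const)
  then have "dderiv (\<lambda>z. dderiv g z y) y y + dderiv g y y = 0" by meson
  then show ?thesis using deriv_radial[OF assms] by (simp add: second_deriv_def)
qed

end

interpretation sgn: zero_homogeneous "sgn :: 'a::euclidean_space \<Rightarrow> 'a"
  by unfold_locales (auto intro: smooth_on_sgn simp: sgn_scaleR)

lemma norm_has_derivative:
  "y \<noteq> 0 \<Longrightarrow> (norm has_derivative (\<lambda>u. sgn y \<bullet> u)) (at y)"
  using has_derivative_norm[of y] by (simp add: inner_commute)

text \<open>Differentiate z = |z| sgn z; in a direction orthogonal to y the norm is
  stationary.\<close>

lemma dderiv_sgn_tangent:
  fixes y :: "'a::euclidean_space"
  assumes "y \<noteq> 0" "y \<bullet> b = 0"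
  shows "dderiv sgn y b = (1 / norm y) *\<^sub>R b"
proof -
  have "((\<lambda>z. norm z *\<^sub>R sgn z) has_derivative
      (\<lambda>u. norm y *\<^sub>R dderiv sgn y u + (sgn y \<bullet> u) *\<^sub>R sgn y)) (at y)"
    by (rule has_derivative_scaleR[OF norm_has_derivative[OF assms(1)] sgn.deriv_at[OF assms(1)]])
  moreover have "(\<lambda>z::'a. norm z *\<^sub>R sgn z) = (\<lambda>z. z)"
  proof
    show "norm z *\<^sub>R sgn z = z" for z :: 'a by (cases "z = 0") (simp_all add: sgn_div_norm)
  qed
  ultimately have "((\<lambda>z. z) has_derivative
      (\<lambda>u. norm y *\<^sub>R dderiv sgn y u + (sgn y \<bullet> u) *\<^sub>R sgn y)) (at y)" by simp
  from has_derivative_unique[OF this has_derivative_ident]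
  have "norm y *\<^sub>R dderiv sgn y b + (sgn y \<bullet> b) *\<^sub>R sgn y = b" by meson
  moreover have "sgn y \<bullet> b = 0" using assms(2) by (simp add: sgn_div_norm)
  ultimately have "norm y *\<^sub>R dderiv sgn y b = b" by simp
  then have "(1 / norm y) *\<^sub>R b = (1 / norm y) *\<^sub>R (norm y *\<^sub>R dderiv sgn y b)" by simp
  then show ?thesis using assms(1) by simp
qed

lemma smooth_on_real_derivative:
  fixes \<rho> :: "real \<Rightarrow> real"
  assumes "smooth_on U \<rho>" "r \<in> U"
  shows "(\<rho> has_real_derivative deriv \<rho> r) (at r)"
proof -
  have d: "(\<rho> has_derivative dderiv \<rho> r) (at r)" using assms by (rule smooth_on_has_derivative)
  have "dderiv \<rho> r = (*) (dderiv \<rho> r 1)"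
  proof
    fix h show "dderiv \<rho> r h = dderiv \<rho> r 1 * h"
      using linear_cmul[OF has_derivative_linear[OF d], of h 1] by (simp add: mult.commute)
  qed
  then have "(\<rho> has_derivative (*) (dderiv \<rho> r 1)) (at r)" using d by metis
  then have "(\<rho> has_real_derivative dderiv \<rho> r 1) (at r)" unfolding has_field_derivative_def .
  then show ?thesis using DERIV_imp_deriv by metis
qed

lemma dderiv_real:
  fixes \<rho> :: "real \<Rightarrow> real"
  assumes "smooth_on U \<rho>" "r \<in> U"
  shows "dderiv \<rho> r h = deriv \<rho> r * h"
  using smooth_on_real_derivative[OF assms] unfolding has_field_derivative_def by (rule dderiv_eqI)

lemma smooth_on_deriv:
  fixes \<rho> :: "real \<Rightarrow> real"
  assumes "open U" "smooth_on U \<rho>"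
  shows "smooth_on U (deriv \<rho>)"
  by (rule smooth_on_cong[OF assms(1) _ smooth_on_dderiv[OF assms(2), of 1]])
    (simp add: dderiv_real[OF assms(2)])

text \<open>Used with the constant profile sin \<theta> on all positive radii for M_{f,\<theta>},
  and with the given \<rho> on U for the cone.\<close>

locale radial_graph = zero_homogeneous g
  for g :: "'a::euclidean_space \<Rightarrow> 'b::euclidean_space" +
  fixes \<rho> :: "real \<Rightarrow> real" and U :: "real set"
  assumes U: "open U" "U \<subseteq> {0<..}" and \<rho>: "smooth_on U \<rho>"
begin

definition domain :: "'a set" where "domain = {y. norm y \<in> U}"

definition F :: "'a \<Rightarrow> 'b" where "F y = \<rho> (norm y) *\<^sub>R g y"

lemma domain_nz: "y \<in> domain \<Longrightarrow> y \<noteq> 0"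
  using U(2) by (auto simp: domain_def)

lemma open_domain: "open domain"
  unfolding domain_def
  using open_vimage[OF U(1), of norm] by (simp add: vimage_def continuous_on_norm_id)

lemma smooth_F: "smooth_on domain F"
  unfolding F_def
proof (rule smooth_on_scaleR[OF open_domain])
  have sub: "domain \<subseteq> - {0}" using domain_nz by blast
  show "smooth_on domain g" by (rule smooth_on_subset[OF smooth sub])
  show "smooth_on domain (\<lambda>y. \<rho> (norm y))"
    by (rule smooth_on_compose[OF open_domain U(1) smooth_on_subset[OF smooth_on_norm sub] \<rho>])
      (auto simp: domain_def)
qed

lemma radial_has_derivative:
  assumes "smooth_on U \<phi>" "y \<in> domain"
  shows "((\<lambda>z. \<phi> (norm z)) has_derivative (\<lambda>u. deriv \<phi> (norm y) * (sgn y \<bullet> u))) (at y)"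
proof -
  have "(\<phi> has_derivative (*) (deriv \<phi> (norm y))) (at (norm y))"
    using smooth_on_real_derivative[OF assms(1)] assms(2)
    unfolding has_field_derivative_def domain_def by blast
  from has_derivative_compose[OF norm_has_derivative[OF domain_nz[OF assms(2)]] this]
  show ?thesis .
qed

lemma dderiv_F:
  assumes "y \<in> domain"
  shows "dderiv F y v = \<rho> (norm y) *\<^sub>R dderiv g y v + (deriv \<rho> (norm y) * (sgn y \<bullet> v)) *\<^sub>R g y"
  unfolding F_def
  by (rule dderiv_eqI[OF has_derivative_scaleR[OF radial_has_derivative[OF \<rho> assms] deriv_at[OF domain_nz[OF assms]]]])

text \<open>Product rule in full; on the diagonal the mixed terms disappear, since Dg kills the
  radial direction and \<open>sgn y\<close> is orthogonal to the others.\<close>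

lemma second_deriv_F:
  assumes "y \<in> domain"
  defines "r \<equiv> norm y"
  shows "second_deriv F y u v =
    \<rho> r *\<^sub>R second_deriv g y u v + (deriv \<rho> r * (sgn y \<bullet> u)) *\<^sub>R dderiv g y v +
    ((deriv \<rho> r * (sgn y \<bullet> v)) *\<^sub>R dderiv g y u +
     (deriv \<rho> r * (dderiv sgn y u \<bullet> v) + deriv (deriv \<rho>) r * (sgn y \<bullet> u) * (sgn y \<bullet> v)) *\<^sub>R g y)"
proof -
  note nz = domain_nz[OF assms(1)]
  note d = radial_has_derivative[OF _ assms(1)]
  have "((\<lambda>z. \<rho> (norm z) *\<^sub>R dderiv g z v + (deriv \<rho> (norm z) * (sgn z \<bullet> v)) *\<^sub>R g z) has_derivative
    (\<lambda>u. \<rho> r *\<^sub>R second_deriv g y u v + (deriv \<rho> r * (sgn y \<bullet> u)) *\<^sub>R dderiv g y v +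
    ((deriv \<rho> r * (sgn y \<bullet> v)) *\<^sub>R dderiv g y u +
     (deriv \<rho> r * (dderiv sgn y u \<bullet> v) + deriv (deriv \<rho>) r * (sgn y \<bullet> u) * (sgn y \<bullet> v)) *\<^sub>R g y))) (at y)"
    unfolding r_def
    by (intro has_derivative_add has_derivative_scaleR has_derivative_mult has_derivative_inner_left
        d \<rho> smooth_on_deriv U second_at deriv_at sgn.deriv_at nz)
  then have "((\<lambda>z. dderiv F z v) has_derivative
    (\<lambda>u. \<rho> r *\<^sub>R second_deriv g y u v + (deriv \<rho> r * (sgn y \<bullet> u)) *\<^sub>R dderiv g y v +
    ((deriv \<rho> r * (sgn y \<bullet> v)) *\<^sub>R dderiv g y u +
     (deriv \<rho> r * (dderiv sgn y u \<bullet> v) + deriv (deriv \<rho>) r * (sgn y \<bullet> u) * (sgn y \<bullet> v)) *\<^sub>R g y))) (at y)"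
    by (rule has_derivative_transform_within_open[OF _ open_domain assms(1)]) (simp add: dderiv_F)
  then show ?thesis unfolding second_deriv_def[of F] by (rule dderiv_eqI)
qed

context
  fixes x :: 'a and r :: real
  assumes x: "norm x = 1" and r: "r \<in> U"
begin

lemma ray: "r *\<^sub>R x \<in> domain" "norm (r *\<^sub>R x) = r" "r > 0" "sgn (r *\<^sub>R x) = x" "x \<noteq> 0"
  "g (r *\<^sub>R x) = g x" "x \<bullet> x = 1"
proof -
  show pos: "r > 0" using r U(2) by auto
  then show n: "norm (r *\<^sub>R x) = r" by (simp add: x)
  then show "r *\<^sub>R x \<in> domain" by (simp add: domain_def r)
  show "sgn (r *\<^sub>R x) = x" using pos by (simp add: sgn_scaleR sgn_div_norm x)
  show "x \<noteq> 0" using x by auto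
  show "g (r *\<^sub>R x) = g x" by (rule hom[OF pos])
  show "x \<bullet> x = 1" using x by (simp add: norm_eq_1)
qed

lemma dderiv_g_ray: "dderiv g (r *\<^sub>R x) x = 0" "dderiv g x x = 0"
  using deriv_scale[OF ray(5,3), of x] deriv_radial[OF ray(5)] by simp_all

lemma dderiv_F_radial: "dderiv F (r *\<^sub>R x) x = deriv \<rho> r *\<^sub>R g x"
  by (simp only: dderiv_F[OF ray(1)] ray dderiv_g_ray) simp

lemma dderiv_F_tangent: "x \<bullet> b = 0 \<Longrightarrow> dderiv F (r *\<^sub>R x) b = (\<rho> r / r) *\<^sub>R dderiv g x b"
  by (simp only: dderiv_F[OF ray(1)] ray deriv_scale[OF ray(5,3)]) simp

lemma second_deriv_F_radial: "second_deriv F (r *\<^sub>R x) x x = deriv (deriv \<rho>) r *\<^sub>R g x"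
proof -
  have "dderiv sgn (r *\<^sub>R x) x = 0"
    using sgn.deriv_scale[OF ray(5,3), of x] sgn.deriv_radial[OF ray(5)] by simp
  moreover have "second_deriv g (r *\<^sub>R x) x x = 0"
    using second_scale[OF ray(5,3), of x x] second_radial[OF ray(5)] by simp
  ultimately show ?thesis
    by (simp only: second_deriv_F[OF ray(1)] ray dderiv_g_ray) simp
qed

text \<open>The term with \<rho>_r / r comes from the Hessian of the norm, which is 1 / r on unit
  vectors tangent to the distance spheres.\<close>

lemma second_deriv_F_tangent:
  assumes "x \<bullet> b = 0"
  shows "second_deriv F (r *\<^sub>R x) b b =
    (\<rho> r / r\<^sup>2) *\<^sub>R second_deriv g x b b + (deriv \<rho> r / r * (b \<bullet> b)) *\<^sub>R g x"
proof -
  have "r *\<^sub>R x \<noteq> 0" using ray(3,5) by simp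
  then have "dderiv sgn (r *\<^sub>R x) b = (1 / r) *\<^sub>R b"
    using dderiv_sgn_tangent[of "r *\<^sub>R x" b] assms ray(2) by simp
  then show ?thesis
    by (simp only: second_deriv_F[OF ray(1)] ray second_scale[OF ray(5,3)] assms) simp
qed

end

end

section \<open>Maps of spheres with one nonzero singular value\<close>

lemma quadratic_nonpos_linear_coeff_zero:
  fixes c d :: real
  assumes "\<And>t. 2 * t * c + t\<^sup>2 * d \<le> 0"
  shows "c = 0"
proof (rule ccontr)
  assume "c \<noteq> 0"
  \<comment> \<open>With k above |d|, the test value t = c / k makes the linear term dominate the
    quadratic one.\<close>
  define k where "k = 1 + \<bar>d\<bar>"
  have k: "k > 0" "d \<ge> - k" by (auto simp: k_def)
  have "2 * (c / k) * c + (c / k)\<^sup>2 * d = (c\<^sup>2 / k\<^sup>2) * (2 * k + d)"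
    using k(1) by (simp add: field_simps power2_eq_square)
  also have "\<dots> > 0" using k \<open>c \<noteq> 0\<close> by (intro mult_pos_pos) auto
  finally show False using assms[of "c / k"] by simp
qed

text \<open>A vector maximizing the norm of the image on the unit sphere of the orthogonal complement of
  the singular space would be a singular vector for another nonzero singular value.\<close>

lemma singular_space_complement_kernel:
  fixes A :: "'a::euclidean_space \<Rightarrow> 'b::euclidean_space"
  assumes V: "subspace V" and A: "linear A"
    and uniq: "\<And>s. singular_value V A s \<Longrightarrow> s \<noteq> 0 \<Longrightarrow> s = l"
    and v: "v \<in> V" "\<And>w. w \<in> singular_space V A l \<Longrightarrow> v \<bullet> w = 0"
  shows "A v = 0"
proof (rule ccontr)
  assume Av: "A v \<noteq> 0"
  let ?E = "singular_space V A l"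
  define K where "K = {v\<in>V. \<forall>w\<in>?E. v \<bullet> w = 0}"
  have subE: "subspace ?E"
    unfolding singular_space_def subspace_def
    using V by (auto simp: subspace_0 subspace_add subspace_scale linear_0[OF A] linear_add[OF A]
        linear_cmul[OF A] inner_add_left distrib_left)
  have subK: "subspace K"
    unfolding K_def subspace_def
    using V by (auto simp: subspace_0 subspace_add subspace_scale inner_add_left)
  have vK: "v \<in> K" using v by (simp add: K_def)
  have v0: "v \<noteq> 0" using Av linear_0[OF A] by auto
  let ?S = "K \<inter> sphere 0 1"
  have "compact ?S" by (rule closed_Int_compact[OF closed_subspace[OF subK] compact_sphere])
  moreover have "sgn v \<in> ?S"
    using subspace_scale[OF subK vK] v0 by (auto simp: sgn_div_norm norm_sgn[unfolded sgn_div_norm])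
  moreover have "continuous_on ?S (\<lambda>z. norm (A z))"
    by (intro continuous_on_norm linear_continuous_on linear_conv_bounded_linear[THEN iffD1] A)
  ultimately obtain m where m: "m \<in> ?S" "\<And>z. z \<in> ?S \<Longrightarrow> norm (A z) \<le> norm (A m)"
    using continuous_attains_sup[of ?S "\<lambda>z. norm (A z)"] by blast
  define s where "s = norm (A m)"
  have mK: "m \<in> K" and m1: "m \<bullet> m = 1" and m0: "m \<noteq> 0" using m(1) by (auto simp: norm_eq_1)
  have bound: "norm (A z) \<le> s * norm z" if "z \<in> K" for z
  proof (cases "z = 0")
    case False
    have "sgn z \<in> ?S"
      using subspace_scale[OF subK that] False by (auto simp: sgn_div_norm norm_sgn[unfolded sgn_div_norm])
    from m(2)[OF this] have "norm (A z) / norm z \<le> s"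
      by (simp add: s_def sgn_div_norm linear_cmul[OF A] divide_inverse mult.commute)
    then show ?thesis using False by (simp add: divide_le_eq mult.commute)
  qed (simp add: linear_0[OF A])
  have "s > 0"
  proof -
    have "0 < norm (A v)" using Av by simp
    then have "0 < s * norm v" using bound[OF vK] by linarith
    then show ?thesis using v0 by (simp add: zero_less_mult_iff)
  qed
  \<comment> \<open>First variation at the maximum: |A z|^2 - s^2 |z|^2 is nonpositive on K and zero
    at m, so its linear coefficient in every direction of K vanishes.\<close>
  have crit: "A m \<bullet> A w = s\<^sup>2 * (m \<bullet> w)" if w: "w \<in> K" for w
  proof -
    have "A m \<bullet> A w - s\<^sup>2 * (m \<bullet> w) = 0"
    proof (rule quadratic_nonpos_linear_coeff_zero)
      fix t
      have "m + t *\<^sub>R w \<in> K" by (intro subspace_add subK mK subspace_scale w)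
      from bound[OF this] have "(norm (A (m + t *\<^sub>R w)))\<^sup>2 \<le> (s * norm (m + t *\<^sub>R w))\<^sup>2"
        by (intro power_mono) auto
      then have "A (m + t *\<^sub>R w) \<bullet> A (m + t *\<^sub>R w) \<le> s\<^sup>2 * ((m + t *\<^sub>R w) \<bullet> (m + t *\<^sub>R w))"
        by (simp add: power_mult_distrib power2_norm_eq_inner)
      moreover have "A m \<bullet> A m = s\<^sup>2" by (simp add: s_def power2_norm_eq_inner)
      ultimately show "2 * t * (A m \<bullet> A w - s\<^sup>2 * (m \<bullet> w)) + t\<^sup>2 * (A w \<bullet> A w - s\<^sup>2 * (w \<bullet> w)) \<le> 0"
        by (simp add: linear_add[OF A] linear_cmul[OF A] inner_add_left inner_add_right m1
            inner_commute[of w m] inner_commute[of "A w" "A m"] algebra_simps power2_eq_square)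
    qed
    then show ?thesis by simp
  qed
  have mV: "m \<in> V" using mK by (simp add: K_def)
  \<comment> \<open>The critical equation passes from K to V because both sides vanish on the
    singular space, to which m is orthogonal.\<close>
  have "A m \<bullet> A w = s\<^sup>2 * (m \<bullet> w)" if w: "w \<in> V" for w
  proof -
    obtain e k where ek: "e \<in> span ?E" "\<And>z. z \<in> span ?E \<Longrightarrow> orthogonal k z" "w = e + k"
      using orthogonal_subspace_decomp_exists[of ?E w] by metis
    have e: "e \<in> ?E" using ek(1) subE by (simp add: span_eq_iff[THEN iffD2])
    then have eV: "e \<in> V" by (simp add: singular_space_def)
    have kw: "k = w - e" using ek(3) by simp
    have "k \<in> V" unfolding kw by (rule subspace_diff[OF V w eV])
    moreover have "\<forall>z\<in>?E. k \<bullet> z = 0" using ek(2) span_base unfolding orthogonal_def by blast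
    ultimately have kK: "k \<in> K" by (simp add: K_def)
    have me: "m \<bullet> e = 0" using mK e by (simp add: K_def)
    have "A e \<bullet> A m = l\<^sup>2 * (e \<bullet> m)" using e mV by (simp add: singular_space_def)
    then have "A m \<bullet> A e = 0" using me by (simp add: inner_commute)
    then show ?thesis using crit[OF kK] me by (simp add: ek(3) linear_add[OF A] inner_add_right)
  qed
  then have ms: "m \<in> singular_space V A s" using mV by (simp add: singular_space_def)
  then have "singular_value V A s" unfolding singular_value_def using m0 \<open>s > 0\<close> by auto
  \<comment> \<open>Now m lies in the singular space for l and in its orthogonal complement.\<close>
  then have "s = l" using uniq \<open>s > 0\<close> by auto
  then have "m \<bullet> m = 0" using mK ms by (simp add: K_def)
  then show False using m1 by simp
qed

lemma orthonormal_basis_of_Un: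
  assumes V: "subspace V" "E \<subseteq> V" "subspace E"
    and BE: "orthonormal_basis_of E BE"
    and BK: "orthonormal_basis_of {v\<in>V. \<forall>w\<in>E. v \<bullet> w = 0} BK"
  shows "orthonormal_basis_of V (BE \<union> BK)" "BE \<inter> BK = {}"
proof -
  let ?K = "{v\<in>V. \<forall>w\<in>E. v \<bullet> w = 0}"
  have sE: "span BE = E" "BE \<subseteq> E" and sK: "span BK = ?K" "BK \<subseteq> ?K"
    using BE BK unfolding orthonormal_basis_of_def by blast+
  have n: "norm b = 1" if "b \<in> BE \<union> BK" for b using BE BK that unfolding orthonormal_basis_of_def by blast
  have cross: "b \<bullet> b' = 0" "b' \<bullet> b = 0" if "b \<in> BE" "b' \<in> BK" for b b'
    using that sE(2) sK(2) by (auto simp: inner_commute)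
  show "BE \<inter> BK = {}"
  proof (rule ccontr)
    assume "BE \<inter> BK \<noteq> {}"
    then obtain b where b: "b \<in> BE" "b \<in> BK" by blast
    then have "b \<bullet> b = 0" by (rule cross)
    then show False using n[of b] b by simp
  qed
  have "span (BE \<union> BK) = V"
  proof
    show "span (BE \<union> BK) \<subseteq> V" using V sE sK by (intro span_minimal) auto
    show "V \<subseteq> span (BE \<union> BK)"
    proof
      fix w assume w: "w \<in> V"
      obtain e k where ek: "e \<in> span E" "\<And>z. z \<in> span E \<Longrightarrow> orthogonal k z" "w = e + k"
        using orthogonal_subspace_decomp_exists[of E w] by metis
      have e: "e \<in> E" using ek(1) V(3) by (simp add: span_eq_iff[THEN iffD2])
      have "k = w - e" using ek(3) by simp
      then have "k \<in> V" using subspace_diff[OF V(1) w] e V(2) by blast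
      moreover have "\<forall>z\<in>E. k \<bullet> z = 0" using ek(2) span_base unfolding orthogonal_def by blast
      ultimately have "k \<in> ?K" by blast
      then have "k \<in> span (BE \<union> BK)" using sK(1) span_mono[of BK "BE \<union> BK"] by blast
      moreover have "e \<in> span (BE \<union> BK)" using e sE(1) span_mono[of BE "BE \<union> BK"] by blast
      ultimately show "w \<in> span (BE \<union> BK)" unfolding ek(3) by (intro span_add)
    qed
  qed
  moreover have "pairwise orthogonal (BE \<union> BK)"
    using BE BK cross unfolding orthonormal_basis_of_def pairwise_def orthogonal_def by blast
  moreover have "BE \<union> BK \<subseteq> V" using sE sK V(2) by blast
  ultimately show "orthonormal_basis_of V (BE \<union> BK)" using n unfolding orthonormal_basis_of_def by blast
qed

lemma orthonormal_basis_of_card: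
  assumes "orthonormal_basis_of V B"
  shows "card B = dim V"
proof -
  have "0 \<notin> B" using assms unfolding orthonormal_basis_of_def by force
  then have "independent B" using assms pairwise_orthogonal_independent unfolding orthonormal_basis_of_def by blast
  then have "dim (span B) = card B" by (simp add: dim_eq_card_independent)
  then show ?thesis using assms unfolding orthonormal_basis_of_def by simp
qed

lemma orthonormal_basis_of_insert:
  fixes x :: "'a::euclidean_space"
  assumes x: "norm x = 1" and B: "orthonormal_basis_of {v. x \<bullet> v = 0} B"
  shows "orthonormal_basis_of UNIV (insert x B)" "x \<notin> B"
proof -
  have E: "orthonormal_basis_of (span {x}) {x}"
    using x unfolding orthonormal_basis_of_def by (auto simp: span_base)
  have K: "{v. x \<bullet> v = 0} = {v\<in>UNIV. \<forall>w\<in>span {x}. v \<bullet> w = 0}"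
    by (auto simp: span_singleton inner_commute)
  have "orthonormal_basis_of UNIV ({x} \<union> B)" "{x} \<inter> B = {}"
    by (rule orthonormal_basis_of_Un[OF subspace_UNIV _ subspace_span E B[unfolded K]], simp)+
  then show "orthonormal_basis_of UNIV (insert x B)" "x \<notin> B" by auto
qed

locale sphere_map =
  fixes f :: "'a::euclidean_space \<Rightarrow> 'b::euclidean_space"
  assumes f: "smooth_map (sphere 0 1) (sphere 0 1) f"
begin

definition ext :: "'a \<Rightarrow> 'b" where "ext y = f (sgn y)"

lemma sgn_sphere: "y \<noteq> 0 \<Longrightarrow> sgn y \<in> sphere 0 (1::real)" for y :: 'a
  by (simp add: norm_sgn)

lemma smooth_ext: "smooth_on (- {0}) ext"
proof (rule smooth_on_local)
  fix y :: 'a assume y: "y \<in> - {0}"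
  then have "sgn y \<in> sphere 0 1" using sgn_sphere by blast
  then obtain W h where W: "open W" "sgn y \<in> W" "smooth_on W h" "\<forall>z\<in>sphere 0 1 \<inter> W. h z = f z"
    using f unfolding smooth_map_def by blast
  let ?V = "(- {0}) \<inter> sgn -` W"
  have V: "open ?V"
    by (rule continuous_open_preimage[OF smooth_on_imp_continuous_on[OF smooth_on_sgn] _ W(1)]) auto
  have "smooth_on ?V (\<lambda>y. h (sgn y))"
    by (rule smooth_on_compose[OF V W(1) smooth_on_subset[OF smooth_on_sgn] W(3)]) auto
  then have "smooth_on ?V ext"
    by (rule smooth_on_cong[OF V, rotated]) (use W(4) sgn_sphere in \<open>auto simp: ext_def\<close>)
  then show "\<exists>V. open V \<and> y \<in> V \<and> smooth_on V ext" using V y W(2) by blast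
qed

sublocale ext: zero_homogeneous ext
  by unfold_locales (simp_all add: smooth_ext ext_def sgn_scaleR)

lemma ext_sphere: "x \<in> sphere 0 1 \<Longrightarrow> ext x = f x"
  by (simp add: ext_def sgn_div_norm)

lemma ext_norm: "y \<noteq> 0 \<Longrightarrow> ext y \<bullet> ext y = 1"
  using f sgn_sphere[of y] unfolding smooth_map_def ext_def by (auto simp: norm_eq_1 image_subset_iff)

lemma ext_inner_deriv:
  assumes "y \<noteq> 0"
  shows "ext y \<bullet> dderiv ext y v = 0"
proof -
  have "((\<lambda>z. ext z \<bullet> ext z) has_derivative (\<lambda>u. ext y \<bullet> dderiv ext y u + dderiv ext y u \<bullet> ext y)) (at y)"
    by (rule has_derivative_inner[OF ext.deriv_at[OF assms] ext.deriv_at[OF assms]])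
  then have "((\<lambda>z. 1) has_derivative (\<lambda>u. ext y \<bullet> dderiv ext y u + dderiv ext y u \<bullet> ext y)) (at y)"
    by (rule has_derivative_transform_within_open[of _ _ _ _ "- {0}"]) (use assms ext_norm in auto)
  from has_derivative_unique[OF this has_derivative_const]
  have "ext y \<bullet> dderiv ext y v + dderiv ext y v \<bullet> ext y = 0" by meson
  then show ?thesis by (simp add: inner_commute)
qed

text \<open>Second differentiation of |f|^2 = 1. Summed over the singular space it fixes the
  f-component of the trace.\<close>

lemma ext_inner_second:
  assumes "y \<noteq> 0"
  shows "ext y \<bullet> second_deriv ext y u v = - (dderiv ext y u \<bullet> dderiv ext y v)"
proof -
  have "((\<lambda>z. ext z \<bullet> dderiv ext z v) has_derivative
      (\<lambda>u. ext y \<bullet> second_deriv ext y u v + dderiv ext y u \<bullet> dderiv ext y v)) (at y)"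
    by (rule has_derivative_inner[OF ext.deriv_at[OF assms] ext.second_at[OF assms]])
  then have "((\<lambda>z. 0) has_derivative (\<lambda>u. ext y \<bullet> second_deriv ext y u v + dderiv ext y u \<bullet> dderiv ext y v)) (at y)"
    by (rule has_derivative_transform_within_open[of _ _ _ _ "- {0}"]) (use assms ext_inner_deriv in auto)
  from has_derivative_unique[OF this has_derivative_const]
  have "ext y \<bullet> second_deriv ext y u v + dderiv ext y u \<bullet> dderiv ext y v = 0" by meson
  then show ?thesis by simp
qed

lemma differential_ext:
  assumes "x \<in> sphere 0 1" "v \<in> sphere_tangent x"
  shows "sphere_differential f x v = dderiv ext x v"
  by (rule differential_eq_dderiv[OF _ smooth_ext _ _ assms(2)]) (use assms(1) ext_sphere in auto)

end

lemma singular_space_cong: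
  assumes "\<And>v. v \<in> V \<Longrightarrow> A v = A' v"
  shows "singular_space V A s = singular_space V A' s"
  unfolding singular_space_def using assms by auto

locale constant_singular_value_map = sphere_map f
  for f :: "'a::euclidean_space \<Rightarrow> 'b::euclidean_space" +
  fixes l :: real and p :: nat
  assumes l: "l \<noteq> 0"
    and unique: "\<And>x s. x \<in> sphere 0 1 \<Longrightarrow>
      singular_value (sphere_tangent x) (sphere_differential f x) s \<Longrightarrow> s \<noteq> 0 \<Longrightarrow> s = l"
    and multiplicity: "\<And>x. x \<in> sphere 0 1 \<Longrightarrow>
      singular_multiplicity (sphere_tangent x) (sphere_differential f x) l = p"
begin

abbreviation A :: "'a \<Rightarrow> 'a \<Rightarrow> 'b" where "A \<equiv> dderiv ext"
abbreviation H :: "'a \<Rightarrow> 'a \<Rightarrow> 'a \<Rightarrow> 'b" where "H \<equiv> second_deriv ext"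

text \<open>\<open>BE\<close> spans the singular space and \<open>BK\<close> the kernel within the
  tangent space. The singular equation is tested against all vectors, as the radial one contributes
  zero to both sides. The count with p + 1 avoids natural-number subtraction and yields n - p kernel
  directions.\<close>

definition adapted :: "'a \<Rightarrow> 'a set \<Rightarrow> 'a set \<Rightarrow> bool" where
  "adapted x BE BK \<longleftrightarrow> orthonormal_basis_of {v. x \<bullet> v = 0} (BE \<union> BK) \<and> BE \<inter> BK = {} \<and>
     finite BE \<and> finite BK \<and> card BE = p \<and> card BK + p + 1 = DIM('a) \<and>
     (\<forall>b\<in>BE. \<forall>w. A x b \<bullet> A x w = l\<^sup>2 * (b \<bullet> w)) \<and> (\<forall>b\<in>BK. A x b = 0)"

lemma adapted_exists:
  assumes x: "norm x = 1"
  shows "\<exists>BE BK. adapted x BE BK"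
proof -
  define V where "V = {v. x \<bullet> v = 0}"
  have xs: "x \<in> sphere 0 1" using x by simp
  have x0: "x \<noteq> 0" using x by auto
  have T: "sphere_tangent x = V" unfolding V_def by (rule tangent_space_sphere) (use x in auto)
  have V: "subspace V" unfolding V_def subspace_def by (auto simp: inner_add_right)
  note A = ext.linear_deriv[OF x0]
  have sp: "singular_space V (sphere_differential f x) s = singular_space V (A x) s" for s
    by (rule singular_space_cong) (use differential_ext[OF xs] T in auto)
  define E where "E = singular_space V (A x) l"
  have Eprop: "A x b \<bullet> A x w = l\<^sup>2 * (b \<bullet> w)" if "b \<in> E" for b w
  proof -
    have bx: "b \<bullet> x = 0" using that by (simp add: E_def singular_space_def V_def inner_commute)
    have xx: "x \<bullet> x = 1" using x by (simp add: norm_eq_1)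
    \<comment> \<open>Tangential part of w; A and the inner product with b do not see the radial
      part that is removed.\<close>
    define w' where "w' = w - (x \<bullet> w) *\<^sub>R x"
    have "w' \<in> V" by (simp add: w'_def V_def inner_diff_right xx)
    then have "A x b \<bullet> A x w' = l\<^sup>2 * (b \<bullet> w')" using that by (simp add: E_def singular_space_def)
    moreover have "A x w' = A x w" "b \<bullet> w' = b \<bullet> w"
      by (simp_all add: w'_def linear_diff[OF A] linear_cmul[OF A] ext.deriv_radial[OF x0]
          inner_diff_right bx)
    ultimately show ?thesis by simp
  qed
  have EV: "E \<subseteq> V" by (auto simp: E_def singular_space_def)
  have subE: "subspace E"
    unfolding E_def singular_space_def subspace_def
    using V by (auto simp: subspace_0 subspace_add subspace_scale linear_0[OF A] linear_add[OF A]
        linear_cmul[OF A] inner_add_left distrib_left)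
  let ?K = "{v\<in>V. \<forall>w\<in>E. v \<bullet> w = 0}"
  have subK: "subspace ?K"
    unfolding subspace_def using V by (auto simp: subspace_0 subspace_add subspace_scale inner_add_left)
  obtain BE where BE: "orthonormal_basis_of E BE" using orthonormal_basis_of_exists[OF subE] by blast
  obtain BK where BK: "orthonormal_basis_of ?K BK" using orthonormal_basis_of_exists[OF subK] by blast
  note fin = orthonormal_basis_of_finite[OF BE] orthonormal_basis_of_finite[OF BK]
  note un = orthonormal_basis_of_Un[OF V EV subE BE BK]
  have cardE: "card BE = p"
    using multiplicity[OF xs] orthonormal_basis_of_card[OF BE]
    by (simp add: T singular_multiplicity_def sp E_def)
  have ins: "orthonormal_basis_of UNIV (insert x (BE \<union> BK))" "x \<notin> BE \<union> BK"
    by (rule orthonormal_basis_of_insert[OF x un(1)[unfolded V_def]])+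
  have "card (insert x (BE \<union> BK)) = DIM('a)"
    using orthonormal_basis_of_card[OF ins(1)] by simp
  then have "card BK + p + 1 = DIM('a)"
    using ins(2) fin un(2) cardE by (simp add: card_Un_disjoint)
  moreover have "A x b = 0" if "b \<in> BK" for b
  proof (rule singular_space_complement_kernel[OF V A])
    show "s = l" if "singular_value V (A x) s" "s \<noteq> 0" for s
      using unique[OF xs, of s] that unfolding T singular_value_def sp by blast
    show "b \<in> V" "\<And>w. w \<in> singular_space V (A x) l \<Longrightarrow> b \<bullet> w = 0"
      using BK that unfolding orthonormal_basis_of_def E_def by blast+
  qed
  moreover have "A x b \<bullet> A x w = l\<^sup>2 * (b \<bullet> w)" if "b \<in> BE" for b w
    using Eprop BE that unfolding orthonormal_basis_of_def by blast
  ultimately have "adapted x BE BK"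
    unfolding adapted_def using un[unfolded V_def] cardE fin by blast
  then show ?thesis by blast
qed

section \<open>The adjoint identity and its derivative\<close>

lemma linear_zero_on_singular_basis:
  assumes x: "norm x = 1" and B: "orthonormal_basis_of {v. x \<bullet> v = 0} B"
    and "linear T" "T x = 0" "\<And>b. b \<in> B \<Longrightarrow> T b = 0"
  shows "T v = 0"
proof (rule linear_eq_0_on_span[OF assms(3)])
  show "v \<in> span (insert x B)"
    using orthonormal_basis_of_insert(1)[OF x B] unfolding orthonormal_basis_of_def by simp
qed (use assms(4,5) in auto)

text \<open>The sum is A A^* A v, with the adjoint written out in the standard basis. Both sides are
  linear in v and agree on x, on the singular basis and on the kernel.\<close>

lemma adjoint_identity_unit:
  assumes x: "norm x = 1"
  shows "(\<Sum>i\<in>Basis. (A x i \<bullet> A x v) *\<^sub>R A x i) = l\<^sup>2 *\<^sub>R A x v"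
proof -
  have x0: "x \<noteq> 0" using x by auto
  note A = ext.linear_deriv[OF x0]
  obtain BE BK where B: "orthonormal_basis_of {v. x \<bullet> v = 0} (BE \<union> BK)"
    "\<And>b w. b \<in> BE \<Longrightarrow> A x b \<bullet> A x w = l\<^sup>2 * (b \<bullet> w)" "\<And>b. b \<in> BK \<Longrightarrow> A x b = 0"
    using adapted_exists[OF x] unfolding adapted_def by blast
  let ?T = "\<lambda>v. (\<Sum>i\<in>Basis. (A x i \<bullet> A x v) *\<^sub>R A x i) - l\<^sup>2 *\<^sub>R A x v"
  have "?T v = 0"
  proof (rule linear_zero_on_singular_basis[OF x B(1)])
    show "linear ?T"
      by (rule linearI) (simp_all add: linear_add[OF A] linear_cmul[OF A] inner_add_right
          scaleR_add_left sum.distrib scaleR_sum_right scaleR_right_diff_distrib algebra_simps)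
    show "?T x = 0" by (simp add: ext.deriv_radial[OF x0])
    fix b assume "b \<in> BE \<union> BK"
    then show "?T b = 0"
    proof
      assume b: "b \<in> BE"
      have "(\<Sum>i\<in>Basis. (A x i \<bullet> A x b) *\<^sub>R A x i) = (\<Sum>i\<in>Basis. l\<^sup>2 *\<^sub>R (b \<bullet> i) *\<^sub>R A x i)"
        by (rule sum.cong[OF refl]) (simp add: inner_commute[of _ "A x b"] B(2)[OF b])
      also have "\<dots> = l\<^sup>2 *\<^sub>R A x b"
        by (simp only: scaleR_sum_right[symmetric] linear_basis_expand[OF A, of b, symmetric])
      finally show ?thesis by simp
    qed (simp add: B(3))
  qed
  then show ?thesis by simp
qed

text \<open>A is homogeneous of degree -1, so the cubic side needs the factor |y|^2. Holding on a
  neighbourhood, the identity can be differentiated with flat derivatives.\<close>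

lemma adjoint_identity:
  assumes y: "y \<noteq> 0"
  shows "(y \<bullet> y) *\<^sub>R (\<Sum>i\<in>Basis. (A y i \<bullet> A y v) *\<^sub>R A y i) = l\<^sup>2 *\<^sub>R A y v"
proof -
  let ?n = "norm y"
  have n: "?n > 0" "norm (sgn y) = 1" "sgn y \<noteq> 0" using y by (auto simp: norm_sgn sgn_zero_iff)
  have "A y v = (1 / ?n) *\<^sub>R A (sgn y) v" for v
    using ext.deriv_scale[OF n(3,1), of v] y by (simp add: sgn_div_norm)
  then have "(y \<bullet> y) *\<^sub>R (\<Sum>i\<in>Basis. (A y i \<bullet> A y v) *\<^sub>R A y i)
    = (y \<bullet> y) *\<^sub>R (1 / ?n ^ 3) *\<^sub>R (\<Sum>i\<in>Basis. (A (sgn y) i \<bullet> A (sgn y) v) *\<^sub>R A (sgn y) i)"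
    by (simp add: scaleR_sum_right power3_eq_cube mult.commute mult.left_commute)
  also have "\<dots> = ((y \<bullet> y) * (1 / ?n ^ 3)) *\<^sub>R l\<^sup>2 *\<^sub>R A (sgn y) v"
    by (simp only: adjoint_identity_unit[OF n(2)] scaleR_scaleR mult.assoc)
  also have "(y \<bullet> y) * (1 / ?n ^ 3) = 1 / ?n"
    using n(1) by (simp add: dot_square_norm power3_eq_cube power2_eq_square)
  also have "(1 / ?n) *\<^sub>R l\<^sup>2 *\<^sub>R A (sgn y) v = l\<^sup>2 *\<^sub>R A y v"
    using \<open>\<And>v. A y v = (1 / ?n) *\<^sub>R A (sgn y) v\<close>[of v] by simp
  finally show ?thesis .
qed

text \<open>Along a tangential X the factor |y|^2 is stationary, so only the three factors of A are
  differentiated.\<close>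

lemma derivative_of_adjoint_identity:
  assumes x: "norm x = 1" and X: "x \<bullet> X = 0"
  shows "(\<Sum>i\<in>Basis. (A x i \<bullet> A x v) *\<^sub>R H x X i + (A x i \<bullet> H x X v + H x X i \<bullet> A x v) *\<^sub>R A x i)
    = l\<^sup>2 *\<^sub>R H x X v"
proof -
  have x0: "x \<noteq> 0" using x by auto
  note d = ext.second_at[OF x0]
  have "((\<lambda>y. (y \<bullet> y) *\<^sub>R (\<Sum>i\<in>Basis. (A y i \<bullet> A y v) *\<^sub>R A y i)) has_derivative
    (\<lambda>X. (x \<bullet> x) *\<^sub>R (\<Sum>i\<in>Basis. (A x i \<bullet> A x v) *\<^sub>R H x X i
      + (A x i \<bullet> H x X v + H x X i \<bullet> A x v) *\<^sub>R A x i)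
      + (x \<bullet> X + X \<bullet> x) *\<^sub>R (\<Sum>i\<in>Basis. (A x i \<bullet> A x v) *\<^sub>R A x i))) (at x)"
    by (intro has_derivative_scaleR has_derivative_inner has_derivative_sum has_derivative_ident d)
  then have "((\<lambda>y. l\<^sup>2 *\<^sub>R A y v) has_derivative
    (\<lambda>X. (x \<bullet> x) *\<^sub>R (\<Sum>i\<in>Basis. (A x i \<bullet> A x v) *\<^sub>R H x X i
      + (A x i \<bullet> H x X v + H x X i \<bullet> A x v) *\<^sub>R A x i)
      + (x \<bullet> X + X \<bullet> x) *\<^sub>R (\<Sum>i\<in>Basis. (A x i \<bullet> A x v) *\<^sub>R A x i))) (at x)"
    by (rule has_derivative_transform_within_open[of _ _ _ _ "- {0}"])
      (use x0 adjoint_identity in auto)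
  from has_derivative_unique[OF this has_derivative_scaleR_right[OF d]]
  have "(x \<bullet> x) *\<^sub>R (\<Sum>i\<in>Basis. (A x i \<bullet> A x v) *\<^sub>R H x X i
      + (A x i \<bullet> H x X v + H x X i \<bullet> A x v) *\<^sub>R A x i)
      + (x \<bullet> X + X \<bullet> x) *\<^sub>R (\<Sum>i\<in>Basis. (A x i \<bullet> A x v) *\<^sub>R A x i) = l\<^sup>2 *\<^sub>R H x X v"
    by meson
  moreover have "x \<bullet> x = 1" "x \<bullet> X + X \<bullet> x = 0" using x X by (simp_all add: norm_eq_1 inner_commute)
  ultimately show ?thesis by simp
qed

text \<open>For v = k in the kernel only the term A A^* H(X,k) survives, and it equals \<lambda>^2
  H(X,k).\<close>

lemma second_deriv_kernel:
  assumes "norm x = 1" "x \<bullet> X = 0" "A x k = 0"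
  shows "H x X k \<in> range (A x)"
proof -
  have "x \<noteq> 0" using assms(1) by auto
  note A = ext.linear_deriv[OF this]
  have "(\<Sum>i\<in>Basis. (A x i \<bullet> H x X k) *\<^sub>R A x i) = l\<^sup>2 *\<^sub>R H x X k"
    using derivative_of_adjoint_identity[OF assms(1,2), of k] by (simp add: assms(3))
  then have "H x X k = (1 / l\<^sup>2) *\<^sub>R (\<Sum>i\<in>Basis. (A x i \<bullet> H x X k) *\<^sub>R A x i)"
    using l by simp
  also have "\<dots> = A x ((1 / l\<^sup>2) *\<^sub>R (\<Sum>i\<in>Basis. (A x i \<bullet> H x X k) *\<^sub>R i))"
    by (simp only: linear_cmul[OF A] linear_sum[OF A])
  finally show ?thesis by blast
qed

text \<open>Pair the differentiated identity for h with A c. The term where the outer A is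
  differentiated gives \<lambda>^2 H(X,h) . A c and cancels the right-hand side; \<lambda>^2 times
  the claim is left.\<close>

lemma second_deriv_skew:
  assumes x: "norm x = 1" and X: "x \<bullet> X = 0"
    and h: "\<And>w. A x h \<bullet> A x w = l\<^sup>2 * (h \<bullet> w)" and c: "\<And>w. A x c \<bullet> A x w = l\<^sup>2 * (c \<bullet> w)"
  shows "H x X c \<bullet> A x h + H x X h \<bullet> A x c = 0"
proof -
  have x0: "x \<noteq> 0" using x by auto
  note A = ext.linear_deriv[OF x0] and HX = ext.linear_second(2)[OF x0, of X]
  have e: "(\<Sum>i\<in>Basis. (w \<bullet> i) * (H x X i \<bullet> z)) = H x X w \<bullet> z" for w z
    by (subst (2) linear_basis_expand[OF HX]) (simp add: inner_sum_left)
  have a: "(\<Sum>i\<in>Basis. (w \<bullet> i) * (A x i \<bullet> z)) = A x w \<bullet> z" for w z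
    by (subst (2) linear_basis_expand[OF A]) (simp add: inner_sum_left)
  have "l\<^sup>2 * (H x X h \<bullet> A x c) = (l\<^sup>2 *\<^sub>R H x X h) \<bullet> A x c" by simp
  also have "\<dots> = (\<Sum>i\<in>Basis. (A x i \<bullet> A x h) *\<^sub>R H x X i + (A x i \<bullet> H x X h + H x X i \<bullet> A x h) *\<^sub>R A x i) \<bullet> A x c"
    by (simp only: derivative_of_adjoint_identity[OF x X, of h])
  also have "\<dots> = (\<Sum>i\<in>Basis. l\<^sup>2 * ((h \<bullet> i) * (H x X i \<bullet> A x c)) +
      (l\<^sup>2 * ((c \<bullet> i) * (A x i \<bullet> H x X h)) + l\<^sup>2 * ((c \<bullet> i) * (H x X i \<bullet> A x h))))"
    unfolding inner_sum_left
    by (rule sum.cong[OF refl])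
      (simp add: inner_add_left inner_commute[of _ "A x h"] h inner_commute[of "A x _" "A x c"] c algebra_simps)
  also have "\<dots> = l\<^sup>2 * (H x X h \<bullet> A x c + (A x c \<bullet> H x X h + H x X c \<bullet> A x h))"
    by (simp only: sum.distrib sum_distrib_left[symmetric] e a distrib_left)
  finally have "l\<^sup>2 * (H x X c \<bullet> A x h + H x X h \<bullet> A x c) = 0"
    by (simp add: algebra_simps inner_commute)
  then show ?thesis using l by simp
qed

text \<open>The form \<open>H x X h \<bullet> A x c\<close> is symmetric in \<open>X, h\<close> and skew in \<open>h, c\<close> on the singular space,
  hence zero there.\<close>

lemma second_deriv_horizontal:
  assumes x: "norm x = 1" and xh: "x \<bullet> h = 0" and xc: "x \<bullet> c = 0"
    and h: "\<And>w. A x h \<bullet> A x w = l\<^sup>2 * (h \<bullet> w)" and c: "\<And>w. A x c \<bullet> A x w = l\<^sup>2 * (c \<bullet> w)"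
  shows "H x h h \<bullet> A x c = 0"
proof -
  have x0: "x \<noteq> 0" using x by auto
  have "H x h c \<bullet> A x h + H x h h \<bullet> A x c = 0" by (rule second_deriv_skew[OF x xh h c])
  \<comment> \<open>Skewness with both arguments equal to h, in direction c, gives H(c,h) . A h =
    0.\<close>
  moreover have "H x c h \<bullet> A x h + H x c h \<bullet> A x h = 0" by (rule second_deriv_skew[OF x xc h h])
  moreover have "H x h c = H x c h" by (rule ext.second_commute[OF x0])
  ultimately show ?thesis by simp
qed

end

section \<open>Lawson-Osserman spheres and cones\<close>

lemma subspace_normal_space:
  assumes "subspace (tangent_space S p)"
  shows "subspace (normal_space S M p)"
  using assms unfolding normal_space_def subspace_def orthogonal_def
  by (auto simp: inner_add_left)

text \<open>The shear (y, z) \<mapsto> (y, z - F y) straightens the graph and is inverted by the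
  opposite shear.\<close>

lemma smooth_submanifold_graph:
  fixes F :: "'a::euclidean_space \<Rightarrow> 'b::euclidean_space"
  assumes G: "open G" and F: "smooth_on G F"
  shows "smooth_submanifold DIM('a) ((\<lambda>y. (y, F y)) ` G)"
  unfolding smooth_submanifold_def
proof
  fix p assume p: "p \<in> (\<lambda>y. (y, F y)) ` G"
  let ?W = "G \<times> (UNIV :: 'b set)"
  let ?\<Phi> = "\<lambda>q. (fst q, snd q - F (fst q))" and ?\<Psi> = "\<lambda>q. (fst q, snd q + F (fst q))"
  let ?V = "(\<lambda>v. (v, 0)) ` (UNIV :: 'a set) :: ('a \<times> 'b) set"
  have W: "open ?W" using G by (simp add: open_Times)
  have fst: "smooth_on ?W fst" and snd: "smooth_on ?W snd"
    by (auto intro!: smooth_on_linear W bounded_linear_fst bounded_linear_snd)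
  have FF: "smooth_on ?W (\<lambda>q. F (fst q))" by (rule smooth_on_compose[OF W G fst F]) auto
  have s: "smooth_on ?W ?\<Phi>" "smooth_on ?W ?\<Psi>"
    by (intro smooth_on_Pair smooth_on_diff smooth_on_add W fst snd FF)+
  have "homeomorphism ?W ?W ?\<Phi> ?\<Psi>"
  proof (rule homeomorphismI)
    show "continuous_on ?W ?\<Phi>" "continuous_on ?W ?\<Psi>" by (intro smooth_on_imp_continuous_on s)+
  qed auto
  moreover have L: "linear (\<lambda>v::'a. (v, 0::'b))" by (auto intro!: linearI)
  then have "subspace ?V" by (intro linear_subspace_image subspace_UNIV)
  moreover have "dim ?V = DIM('a)"
    using dim_image_eq[OF L, of UNIV] by (simp add: inj_on_def)
  moreover have "?\<Phi> ` (?W \<inter> (\<lambda>y. (y, F y)) ` G) = ?W \<inter> ?V"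
    by force
  moreover have "p \<in> ?W" using p by auto
  ultimately show "\<exists>W W' \<Phi> \<Psi> (V::('a \<times> 'b) set).
      open W \<and> open W' \<and> p \<in> W \<and> homeomorphism W W' \<Phi> \<Psi> \<and> smooth_on W \<Phi> \<and> smooth_on W' \<Psi> \<and>
      subspace V \<and> dim V = DIM('a) \<and> \<Phi> ` (W \<inter> (\<lambda>y. (y, F y)) ` G) = W' \<inter> V"
    using W s by blast
qed

context smooth_graph
begin

text \<open>Each w in the target completes to a vector (a, w) orthogonal to the lifts of all
  directions, not only of those tangent to the base.\<close>

lemma normal_vector_exists:
  obtains a where "\<And>u. a \<bullet> u = - (w \<bullet> dderiv F y0 u)"
proof
  show "- adjoint (dderiv F y0) w \<bullet> u = - (w \<bullet> dderiv F y0 u)" for u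
    using adjoint_works[OF linear_dderiv[OF F y0G], of u w] by (simp add: inner_commute)
qed

lemma in_normal_space_graph:
  assumes "(a, w) \<in> tangent_space S base" "\<And>u. a \<bullet> u = - (w \<bullet> dderiv F y0 u)"
  shows "(a, w) \<in> normal_space S graph base"
  using assms unfolding normal_space_def orthogonal_def
  by (auto simp: tangent_graph[OF y0])

end

context constant_singular_value_map
begin

context
  fixes x BE BK
  assumes x: "norm x = 1" and ad: "adapted x BE BK"
begin

lemma adapted_props:
  "orthonormal_basis_of {v. x \<bullet> v = 0} (BE \<union> BK)" "BE \<inter> BK = {}" "finite BE" "finite BK"
  "card BE = p" "card BK + p + 1 = DIM('a)"
  "b \<in> BE \<Longrightarrow> A x b \<bullet> A x w = l\<^sup>2 * (b \<bullet> w)" "b \<in> BK \<Longrightarrow> A x b = 0"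
  using ad unfolding adapted_def by blast+

lemma adapted_tangent: "b \<in> BE \<union> BK \<Longrightarrow> x \<bullet> b = 0"
  and adapted_unit: "b \<in> BE \<union> BK \<Longrightarrow> b \<bullet> b = 1"
  and adapted_orth: "b \<in> BE \<union> BK \<Longrightarrow> b' \<in> BE \<union> BK \<Longrightarrow> b \<noteq> b' \<Longrightarrow> b \<bullet> b' = 0"
  using adapted_props(1) unfolding orthonormal_basis_of_def pairwise_def orthogonal_def
  by (auto simp: norm_eq_1)

lemma adapted_image_orth:
  "b \<in> BE \<union> BK \<Longrightarrow> b' \<in> BE \<union> BK \<Longrightarrow> b \<noteq> b' \<Longrightarrow> A x b \<bullet> A x b' = 0"
  using adapted_props(7)[of b b'] adapted_props(8)[of b] adapted_orth[of b b'] by auto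

lemma adapted_norm:
  "b \<in> BE \<Longrightarrow> (norm (A x b))\<^sup>2 = l\<^sup>2" "b \<in> BK \<Longrightarrow> (norm (A x b))\<^sup>2 = 0"
  using adapted_props(7)[of b b] adapted_unit[of b] adapted_props(8)[of b]
  by (auto simp: power2_norm_eq_inner)

text \<open>With \<open>S\<^sub>E\<close> and \<open>S\<^sub>K\<close> the traces of the second derivative over the singular space and over the
  kernel, the hypothesis says that \<open>S\<^sub>E / k + S\<^sub>K\<close> is a multiple of the position vector. As
  \<open>S\<^sub>K\<close> lies in the image of the differential and \<open>S\<^sub>E\<close> is orthogonal to it, both parts are determined.\<close>

lemma traces_of_weighted_trace:
  fixes k :: real
  assumes k: "k > 0"
    and w: "\<And>w. w \<bullet> ext x = 0 \<Longrightarrow> (\<Sum>b\<in>BE. w \<bullet> H x b b) / k + (\<Sum>b\<in>BK. w \<bullet> H x b b) = 0"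
  shows "(\<Sum>b\<in>BK. H x b b) = 0" "(\<Sum>b\<in>BE. H x b b) = - (real p * l\<^sup>2) *\<^sub>R ext x"
proof -
  have x0: "x \<noteq> 0" using x by auto
  note A = ext.linear_deriv[OF x0]
  define SE where "SE = (\<Sum>b\<in>BE. H x b b)"
  define SK where "SK = (\<Sum>b\<in>BK. H x b b)"
  have w': "(w \<bullet> SE) / k + w \<bullet> SK = 0" if "w \<bullet> ext x = 0" for w
    using w[OF that] by (simp add: SE_def SK_def inner_sum_right)
  have ff: "ext x \<bullet> ext x = 1" by (rule ext_norm[OF x0])
  have "SK \<in> range (A x)"
    unfolding SK_def
    using linear_subspace_image[OF A subspace_UNIV] adapted_tangent adapted_props(8)
    by (intro subspace_sum second_deriv_kernel[OF x]) auto
  then obtain z where z: "SK = A x z" by blast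
  have "SE \<bullet> A x v = 0" for v
  proof (rule linear_zero_on_singular_basis[OF x adapted_props(1)])
    show "linear (\<lambda>v. SE \<bullet> A x v)"
      by (rule linearI) (simp_all add: linear_add[OF A] linear_cmul[OF A] inner_add_right)
    show "SE \<bullet> A x x = 0" by (simp add: ext.deriv_radial[OF x0])
    fix c assume c: "c \<in> BE \<union> BK"
    show "SE \<bullet> A x c = 0"
    proof (cases "c \<in> BE")
      case True
      have "H x b b \<bullet> A x c = 0" if "b \<in> BE" for b
        by (rule second_deriv_horizontal[OF x adapted_tangent adapted_tangent])
          (use that True adapted_props(7) in auto)
      then show ?thesis by (simp add: SE_def inner_sum_left)
    qed (use c adapted_props(8) in auto)
  qed
  then have "SK \<bullet> SE = 0" using z by (simp add: inner_commute)
  moreover have "SK \<bullet> ext x = 0"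
    using ext_inner_deriv[OF x0, of z] z by (simp add: inner_commute)
  ultimately have "SK \<bullet> SK = 0" using w'[of SK] by simp
  then have SK: "SK = 0" by simp
  then show "(\<Sum>b\<in>BK. H x b b) = 0" by (simp add: SK_def)
  have "ext x \<bullet> SE = (\<Sum>b\<in>BE. - (l\<^sup>2))"
    unfolding SE_def inner_sum_right
    by (rule sum.cong[OF refl])
      (use adapted_norm(1) in \<open>auto simp: ext_inner_second[OF x0] power2_norm_eq_inner\<close>)
  then have fSE: "ext x \<bullet> SE = - (real p * l\<^sup>2)" by (simp add: adapted_props(5))
  define u where "u = SE - (ext x \<bullet> SE) *\<^sub>R ext x"
  have uf: "u \<bullet> ext x = 0" using ff by (simp add: u_def inner_diff_left inner_commute[of SE])
  have "u \<bullet> SE = 0" using w'[OF uf] SK k by simp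
  moreover have "u \<bullet> u = u \<bullet> SE - (ext x \<bullet> SE) * (u \<bullet> ext x)"
    by (subst (2) u_def) (simp add: inner_diff_right)
  ultimately have "u \<bullet> u = 0" using uf by simp
  then have "SE = (ext x \<bullet> SE) *\<^sub>R ext x" by (simp add: u_def)
  then show "(\<Sum>b\<in>BE. H x b b) = - (real p * l\<^sup>2) *\<^sub>R ext x" using fSE by (simp add: SE_def)
qed

text \<open>M_{f,\<theta>} is the graph of sin \<theta> times the extension over the sphere of
  radius cos \<theta>; its minimality, tested with w orthogonal to f, is the weighted trace
  relation.\<close>

lemma LO_sphere_traces:
  assumes \<theta>: "0 < \<theta>" "\<theta> < pi / 2" and min: "minimal_submanifold (sphere 0 1) (LO_sphere f \<theta>)"
  shows "(\<Sum>b\<in>BK. H x b b) = 0" "(\<Sum>b\<in>BE. H x b b) = - (real p * l\<^sup>2) *\<^sub>R ext x"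
proof -
  define c where "c = cos \<theta>"
  define s where "s = sin \<theta>"
  have c: "c > 0" using \<theta> by (simp add: c_def cos_gt_zero)
  have s: "s > 0" using \<theta> by (simp add: s_def sin_gt_zero)
  have cs: "c\<^sup>2 + s\<^sup>2 = 1" by (simp add: c_def s_def)
  have x0: "x \<noteq> 0" using x by auto
  \<comment> \<open>With constant profile the tangential formulas become DF = (s / c) A and D^2F =
    (s / c^2) H.\<close>
  interpret rg: radial_graph ext "\<lambda>_. s" "{0<..}"
    by unfold_locales (auto intro: smooth_on_const)
  let ?N = "sphere (0::'a) c"
  have Fext: "rg.F y = s *\<^sub>R ext y" for y by (simp add: rg.F_def)
  have M: "LO_sphere f \<theta> = (\<lambda>y. (y, rg.F y)) ` ?N"
  proof (intro equalityI subsetI)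
    fix q assume "q \<in> LO_sphere f \<theta>"
    then obtain z where z: "z \<in> sphere 0 1" "q = (c *\<^sub>R z, s *\<^sub>R f z)"
      unfolding LO_sphere_def c_def s_def by blast
    have "c *\<^sub>R z \<in> ?N" using z(1) c by simp
    moreover have "q = (c *\<^sub>R z, rg.F (c *\<^sub>R z))"
      using z ext.hom[OF c, of z] ext_sphere[OF z(1)] by (simp add: Fext)
    ultimately show "q \<in> (\<lambda>y. (y, rg.F y)) ` ?N" by blast
  next
    fix q assume "q \<in> (\<lambda>y. (y, rg.F y)) ` ?N"
    then obtain y where y: "norm y = c" "q = (y, rg.F y)" by auto
    have "sgn y \<in> sphere 0 1" using y(1) c by (auto simp: norm_sgn)
    moreover have "q = (c *\<^sub>R sgn y, s *\<^sub>R f (sgn y))"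
      using y c by (simp add: Fext ext_def sgn_div_norm)
    ultimately show "q \<in> LO_sphere f \<theta>" unfolding LO_sphere_def c_def s_def by blast
  qed
  have y0N: "c *\<^sub>R x \<in> ?N" using x c by simp
  have base: "(c *\<^sub>R x, rg.F (c *\<^sub>R x)) \<in> sphere 0 1"
  proof -
    have "(c *\<^sub>R x, rg.F (c *\<^sub>R x)) \<in> LO_sphere f \<theta>" unfolding M using y0N by blast
    then show ?thesis using min unfolding minimal_submanifold_def by blast
  qed
  have TS: "tangent_space (sphere 0 1) (c *\<^sub>R x, rg.F (c *\<^sub>R x)) = {v. (c *\<^sub>R x, rg.F (c *\<^sub>R x)) \<bullet> v = 0}"
    by (rule tangent_space_sphere[OF zero_less_one base])
  interpret sg: smooth_graph rg.F rg.domain ?N 1 "c *\<^sub>R x" "sphere 0 1"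
  proof unfold_locales
    show "?N \<subseteq> rg.domain" using c by (auto simp: rg.domain_def)
    show "tangent_space ?N y = {v. 1 * (y \<bullet> v) = 0}" if "y \<in> ?N" for y
      using tangent_space_sphere[OF c that] by simp
    show "(1::real) = 0 \<or> 1 = (1::real) \<and> c *\<^sub>R x \<noteq> 0 \<and> (\<forall>y\<in>?N. y \<bullet> y = (c *\<^sub>R x) \<bullet> (c *\<^sub>R x))"
      using c x0 y0N by (auto simp: dot_square_norm)
    show "subspace (normal_space (sphere 0 1) ((\<lambda>y. (y, rg.F y)) ` ?N) (c *\<^sub>R x, rg.F (c *\<^sub>R x)))"
      by (rule subspace_normal_space) (auto simp: TS subspace_def inner_add_right)
  qed (fact rg.open_domain rg.smooth_F y0N)+
  have cU: "c \<in> {0<..}" using c by simp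
  have DF: "dderiv rg.F (c *\<^sub>R x) b = (s / c) *\<^sub>R A x b" if "x \<bullet> b = 0" for b
    by (rule rg.dderiv_F_tangent[OF x cU that])
  have nDF: "(norm (dderiv rg.F (c *\<^sub>R x) b))\<^sup>2 = (s / c)\<^sup>2 * (norm (A x b))\<^sup>2" if "x \<bullet> b = 0" for b
    by (simp only: DF[OF that] norm_scaleR power_mult_distrib power2_abs)
  have D2F: "second_deriv rg.F (c *\<^sub>R x) b b = (s / c\<^sup>2) *\<^sub>R H x b b" if "x \<bullet> b = 0" for b
    using rg.second_deriv_F_tangent[OF x cU that] by simp
  have T: "tangent_space ?N (c *\<^sub>R x) = {v. x \<bullet> v = 0}"
    using tangent_space_sphere[OF c y0N] c by auto
  \<comment> \<open>Squared length of the graph lift of a unit vector in the singular space; for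
    kernel vectors it is 1.\<close>
  define k where "k = 1 + (s / c)\<^sup>2 * l\<^sup>2"
  have k: "k > 0" unfolding k_def by (simp add: add_pos_nonneg)
  have "(\<Sum>b\<in>BE. w \<bullet> H x b b) / k + (\<Sum>b\<in>BK. w \<bullet> H x b b) = 0" if w: "w \<bullet> ext x = 0" for w
  proof -
    obtain a where a: "\<And>u. a \<bullet> u = - (w \<bullet> dderiv rg.F (c *\<^sub>R x) u)"
      using sg.normal_vector_exists[of w] by blast
    have "dderiv rg.F (c *\<^sub>R x) x = 0"
      using rg.dderiv_F_radial[OF x cU] by simp
    \<comment> \<open>This makes tangency of (a, w) to the ambient sphere a condition on w
      alone.\<close>
    then have "a \<bullet> x = 0" using a[of x] by simp
    then have "(c *\<^sub>R x, rg.F (c *\<^sub>R x)) \<bullet> (a, w) = 0"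
      using w ext.hom[OF c, of x] by (simp add: Fext inner_commute)
    then have \<nu>: "(a, w) \<in> normal_space (sphere 0 1) sg.graph (c *\<^sub>R x, rg.F (c *\<^sub>R x))"
      by (intro sg.in_normal_space_graph a) (simp add: TS)
    have "mean_curvature (sphere 0 1) sg.graph (c *\<^sub>R x, rg.F (c *\<^sub>R x)) = 0"
      using min y0N unfolding minimal_submanifold_def M sg.graph_def by blast
    moreover have "mean_curvature (sphere 0 1) sg.graph (c *\<^sub>R x, rg.F (c *\<^sub>R x)) \<bullet> (a, w)
      = (\<Sum>b\<in>BE \<union> BK. w \<bullet> second_deriv rg.F (c *\<^sub>R x) b b / (1 + (norm (dderiv rg.F (c *\<^sub>R x) b))\<^sup>2))"
    proof (rule sg.mean_curvature_graph_inner[OF _ _ \<nu> a])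
      show "orthonormal_basis_of (tangent_space ?N (c *\<^sub>R x)) (BE \<union> BK)"
        unfolding T by (rule adapted_props(1))
      show "dderiv rg.F (c *\<^sub>R x) b \<bullet> dderiv rg.F (c *\<^sub>R x) b' = 0"
        if "b \<in> BE \<union> BK" "b' \<in> BE \<union> BK" "b \<noteq> b'" for b b'
        unfolding DF[OF adapted_tangent[OF that(1)]] DF[OF adapted_tangent[OF that(2)]]
        using adapted_image_orth[OF that] by simp
    qed
    ultimately have "0 = (\<Sum>b\<in>BE \<union> BK. w \<bullet> second_deriv rg.F (c *\<^sub>R x) b b / (1 + (norm (dderiv rg.F (c *\<^sub>R x) b))\<^sup>2))"
      by simp
    also have "\<dots> = (\<Sum>b\<in>BE. w \<bullet> second_deriv rg.F (c *\<^sub>R x) b b / (1 + (norm (dderiv rg.F (c *\<^sub>R x) b))\<^sup>2))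
      + (\<Sum>b\<in>BK. w \<bullet> second_deriv rg.F (c *\<^sub>R x) b b / (1 + (norm (dderiv rg.F (c *\<^sub>R x) b))\<^sup>2))"
      by (rule sum.union_disjoint) (use adapted_props in auto)
    also have "(\<Sum>b\<in>BE. w \<bullet> second_deriv rg.F (c *\<^sub>R x) b b / (1 + (norm (dderiv rg.F (c *\<^sub>R x) b))\<^sup>2))
      = (\<Sum>b\<in>BE. s / c\<^sup>2 * (w \<bullet> H x b b / k))"
      by (rule sum.cong[OF refl])
        (simp add: nDF D2F adapted_tangent adapted_norm k_def)
    also have "(\<Sum>b\<in>BK. w \<bullet> second_deriv rg.F (c *\<^sub>R x) b b / (1 + (norm (dderiv rg.F (c *\<^sub>R x) b))\<^sup>2))
      = (\<Sum>b\<in>BK. s / c\<^sup>2 * (w \<bullet> H x b b))"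
      by (rule sum.cong[OF refl])
        (simp add: DF D2F adapted_tangent adapted_props(8))
    finally have "s / c\<^sup>2 * ((\<Sum>b\<in>BE. w \<bullet> H x b b) / k + (\<Sum>b\<in>BK. w \<bullet> H x b b)) = 0"
      by (simp only: sum_distrib_left[symmetric] sum_divide_distrib[symmetric] distrib_left)
    then show ?thesis using s c by simp
  qed
  from traces_of_weighted_trace[OF k this]
  show "(\<Sum>b\<in>BK. H x b b) = 0" "(\<Sum>b\<in>BE. H x b b) = - (real p * l\<^sup>2) *\<^sub>R ext x" by blast+
qed

end

section \<open>Mean curvature of the cone\<close>

lemma LO_cone_eq_graph:
  assumes U: "U \<subseteq> {0<..}"
  shows "LO_cone f \<rho> U = (\<lambda>y. (y, \<rho> (norm y) *\<^sub>R ext y)) ` {y. norm y \<in> U}"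
proof (intro equalityI subsetI)
  fix q assume "q \<in> LO_cone f \<rho> U"
  then obtain z r where z: "z \<in> sphere 0 1" "r \<in> U" "q = (r *\<^sub>R z, \<rho> r *\<^sub>R f z)"
    unfolding LO_cone_def by blast
  have r: "r > 0" using z(2) U by auto
  then have n: "norm (r *\<^sub>R z) = r" using z(1) by simp
  then have "q = (r *\<^sub>R z, \<rho> (norm (r *\<^sub>R z)) *\<^sub>R ext (r *\<^sub>R z))"
    using z(3) ext.hom[OF r, of z] ext_sphere[OF z(1)] by simp
  moreover have "r *\<^sub>R z \<in> {y. norm y \<in> U}" using n z(2) by simp
  ultimately show "q \<in> (\<lambda>y. (y, \<rho> (norm y) *\<^sub>R ext y)) ` {y. norm y \<in> U}" by blast
next
  fix q assume "q \<in> (\<lambda>y. (y, \<rho> (norm y) *\<^sub>R ext y)) ` {y. norm y \<in> U}"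
  then obtain y where y: "norm y \<in> U" "q = (y, \<rho> (norm y) *\<^sub>R ext y)" by blast
  then have y0: "y \<noteq> 0" using U by auto
  have "q = (norm y *\<^sub>R sgn y, \<rho> (norm y) *\<^sub>R f (sgn y))"
    using y(2) y0 by (simp add: ext_def sgn_div_norm)
  then show "q \<in> LO_cone f \<rho> U" unfolding LO_cone_def using sgn_sphere[OF y0] y(1) by blast
qed

text \<open>Pairing the mean curvature with a normal (a, w) gives the differential expression times
  w . f. Choosing w = f yields one direction; for the other the mean curvature, being normal, is
  paired with itself.\<close>

lemma mean_curvature_LO_cone_zero_iff:
  assumes \<theta>: "0 < \<theta>" "\<theta> < pi / 2" and min: "minimal_submanifold (sphere 0 1) (LO_sphere f \<theta>)"
    and dim: "DIM('a) = n + 1"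
    and U: "open U" "U \<subseteq> {0<..}" and \<rho>: "smooth_on U \<rho>"
    and x: "norm x = 1" and r: "r \<in> U"
  shows "mean_curvature UNIV (LO_cone f \<rho> U) (r *\<^sub>R x, \<rho> r *\<^sub>R ext x) = 0 \<longleftrightarrow>
    deriv (deriv \<rho>) r / (1 + (deriv \<rho> r)\<^sup>2) + (real n - real p) * deriv \<rho> r / r
      + real p * (deriv \<rho> r / r - l\<^sup>2 * \<rho> r / r\<^sup>2) / (1 + l\<^sup>2 * (\<rho> r)\<^sup>2 / r\<^sup>2) = 0"
    (is "?h = 0 \<longleftrightarrow> ?ode = 0")
proof -
  have x0: "x \<noteq> 0" using x by auto
  have rpos: "r > 0" using r U(2) by auto
  interpret rg: radial_graph ext \<rho> U by unfold_locales (fact U \<rho>)+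
  have y0: "r *\<^sub>R x \<in> rg.domain" by (rule rg.ray(1)[OF x r])
  have F0: "rg.F (r *\<^sub>R x) = \<rho> r *\<^sub>R ext x"
    using rg.ray(2,6)[OF x r] by (simp add: rg.F_def)
  have Tdom: "tangent_space rg.domain y = UNIV" if "y \<in> rg.domain" for y
    by (rule tangent_space_open[OF rg.open_domain that])
  have TU: "tangent_space UNIV q = UNIV" for q :: "'a \<times> 'b"
    by (rule tangent_space_open) auto
  interpret sg: smooth_graph rg.F rg.domain rg.domain 0 "r *\<^sub>R x" UNIV
  proof unfold_locales
    show "subspace (normal_space UNIV ((\<lambda>y. (y, rg.F y)) ` rg.domain) (r *\<^sub>R x, rg.F (r *\<^sub>R x)))"
      by (rule subspace_normal_space) (simp add: TU)
  qed (use rg.open_domain rg.smooth_F y0 Tdom in auto)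
  have M: "LO_cone f \<rho> U = sg.graph"
    unfolding LO_cone_eq_graph[OF U(2)] sg.graph_def unfolding rg.domain_def rg.F_def ..
  obtain BE BK where ad: "adapted x BE BK" using adapted_exists[OF x] by blast
  note bp = adapted_props[OF x ad]
  note traces = LO_sphere_traces[OF x ad \<theta> min]
  let ?B = "insert x (BE \<union> BK)"
  note ins = orthonormal_basis_of_insert[OF x bp(1)]
  have ff: "ext x \<bullet> ext x = 1" by (rule ext_norm[OF x0])
  note DFx = rg.dderiv_F_radial[OF x r] and DF = rg.dderiv_F_tangent[OF x r]
  note D2Fx = rg.second_deriv_F_radial[OF x r] and D2F = rg.second_deriv_F_tangent[OF x r]
  have nDF: "(norm (dderiv rg.F (r *\<^sub>R x) b))\<^sup>2 = (\<rho> r / r)\<^sup>2 * (norm (A x b))\<^sup>2" if "x \<bullet> b = 0" for b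
    by (simp only: DF[OF that] norm_scaleR power_mult_distrib power2_abs)
  define k where "k = 1 + (\<rho> r / r)\<^sup>2 * l\<^sup>2"
  have orth: "dderiv rg.F (r *\<^sub>R x) b \<bullet> dderiv rg.F (r *\<^sub>R x) b' = 0"
    if bb: "b \<in> ?B" "b' \<in> ?B" "b \<noteq> b'" for b b'
  proof -
    \<comment> \<open>The radial image is a multiple of f, the tangential images are multiples of A
      b, and f is orthogonal to the image of A.\<close>
    have xb: "dderiv rg.F (r *\<^sub>R x) x \<bullet> dderiv rg.F (r *\<^sub>R x) b = 0" if "b \<in> BE \<union> BK" for b
      using adapted_tangent[OF x ad that] by (simp add: DFx DF ext_inner_deriv[OF x0])
    consider "b = x" "b' \<in> BE \<union> BK" | "b' = x" "b \<in> BE \<union> BK" | "b \<in> BE \<union> BK" "b' \<in> BE \<union> BK"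
      using bb by blast
    then show ?thesis
    proof cases
      case 1 then show ?thesis using xb by simp
    next
      case 2 then show ?thesis using xb by (simp add: inner_commute)
    next
      case 3 then show ?thesis
        using adapted_tangent[OF x ad] adapted_image_orth[OF x ad _ _ bb(3)] by (simp add: DF)
    qed
  qed
  have inner: "?h \<bullet> (a, w) = ?ode * (w \<bullet> ext x)"
    if a: "\<And>u. a \<bullet> u = - (w \<bullet> dderiv rg.F (r *\<^sub>R x) u)" for a w
  proof -
    let ?t = "\<lambda>b. w \<bullet> second_deriv rg.F (r *\<^sub>R x) b b / (1 + (norm (dderiv rg.F (r *\<^sub>R x) b))\<^sup>2)"
    have \<nu>: "(a, w) \<in> normal_space UNIV sg.graph (r *\<^sub>R x, rg.F (r *\<^sub>R x))"
      by (rule sg.in_normal_space_graph[OF _ a]) (simp add: TU)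
    have onb: "orthonormal_basis_of (tangent_space rg.domain (r *\<^sub>R x)) ?B"
      unfolding Tdom[OF y0] by (rule ins(1))
    have "?h \<bullet> (a, w) = (\<Sum>b\<in>?B. ?t b)"
      unfolding M F0[symmetric] by (rule sg.mean_curvature_graph_inner[OF onb orth \<nu> a])
    also have "\<dots> = ?t x + ((\<Sum>b\<in>BE. ?t b) + (\<Sum>b\<in>BK. ?t b))"
      using bp(2,3,4) ins(2) by (simp add: sum.union_disjoint)
    also have "?t x = deriv (deriv \<rho>) r / (1 + (deriv \<rho> r)\<^sup>2) * (w \<bullet> ext x)"
      using ff by (simp add: D2Fx DFx power_mult_distrib power2_norm_eq_inner)
    also have "(\<Sum>b\<in>BE. ?t b) = (\<Sum>b\<in>BE. (\<rho> r / r\<^sup>2 * (w \<bullet> H x b b) + deriv \<rho> r / r * (w \<bullet> ext x)) / k)"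
      by (rule sum.cong[OF refl])
        (simp add: nDF D2F adapted_tangent[OF x ad] adapted_unit[OF x ad] adapted_norm[OF x ad]
          inner_add_right k_def)
    also have "\<dots> = (\<rho> r / r\<^sup>2 * (w \<bullet> (\<Sum>b\<in>BE. H x b b)) + real p * (deriv \<rho> r / r * (w \<bullet> ext x))) / k"
      by (simp add: sum_divide_distrib[symmetric] sum.distrib sum_distrib_left[symmetric] inner_sum_right bp(5))
    \<comment> \<open>The trace -p \<lambda>^2 f over the singular space supplies the term with
      \<lambda>^2 \<rho> / r^2.\<close>
    also have "\<dots> = (real p * (deriv \<rho> r / r - l\<^sup>2 * \<rho> r / r\<^sup>2) / k) * (w \<bullet> ext x)"
      unfolding traces(2) by (simp add: algebra_simps)
    also have "(\<Sum>b\<in>BK. ?t b) = (\<Sum>b\<in>BK. \<rho> r / r\<^sup>2 * (w \<bullet> H x b b) + deriv \<rho> r / r * (w \<bullet> ext x))"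
      by (rule sum.cong[OF refl])
        (simp add: DF D2F adapted_tangent[OF x ad] adapted_unit[OF x ad] bp(8) inner_add_right)
    also have "\<dots> = \<rho> r / r\<^sup>2 * (w \<bullet> (\<Sum>b\<in>BK. H x b b)) + real (card BK) * (deriv \<rho> r / r * (w \<bullet> ext x))"
      by (simp add: sum.distrib inner_sum_right sum_distrib_left sum_divide_distrib)
    \<comment> \<open>Over the kernel H has trace 0, so each of the n - p directions contributes
      just \<rho>_r / r.\<close>
    also have "\<dots> = ((real n - real p) * deriv \<rho> r / r) * (w \<bullet> ext x)"
    proof -
      have "card BK + p = n" using bp(6) dim by simp
      then have "real (card BK) = real n - real p" by linarith
      then show ?thesis unfolding traces(1) by simp
    qed
    also have "k = 1 + l\<^sup>2 * (\<rho> r)\<^sup>2 / r\<^sup>2" by (simp add: k_def power_divide mult.commute)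
    finally show ?thesis by (simp add: algebra_simps)
  qed
  show ?thesis
  proof
    assume "?h = 0"
    moreover obtain a where "\<And>u. a \<bullet> u = - (ext x \<bullet> dderiv rg.F (r *\<^sub>R x) u)"
      using sg.normal_vector_exists[of "ext x"] by blast
    ultimately show "?ode = 0" using inner[of a "ext x"] ff by simp
  next
    assume ode: "?ode = 0"
    obtain a w where h: "?h = (a, w)" by fastforce
    have "(a, w) \<in> normal_space UNIV sg.graph (r *\<^sub>R x, rg.F (r *\<^sub>R x))"
      using sg.mean_curvature_graph_in_normal h unfolding M F0[symmetric] by simp
    then have "\<forall>v. (a, w) \<bullet> (v, dderiv rg.F (r *\<^sub>R x) v) = 0"
      unfolding normal_space_def sg.tangent_graph[OF y0] Tdom[OF y0] orthogonal_def by blast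
    then have "a \<bullet> u = - (w \<bullet> dderiv rg.F (r *\<^sub>R x) u)" for u by (simp add: eq_neg_iff_add_eq_0)
    then have "?h \<bullet> (a, w) = 0" using inner ode by simp
    then show "?h = 0" unfolding h by (metis inner_eq_zero_iff)
  qed
qed

end

theorem theorem3p2:
  fixes f :: "'a::euclidean_space \<Rightarrow> 'b::euclidean_space"
    and n m p :: nat and l :: real
    and \<rho> :: "real \<Rightarrow> real" and U :: "real set"
  assumes dim_a: "DIM('a) = n + 1" and dim_b: "DIM('b) = m + 1"
    and f: "LOMSE f"
    and sv: "nonzero_singular_value_with_multiplicity f l p"
    and U: "open U" "U \<subseteq> {0<..}"
    and \<rho>: "smooth_on U \<rho>"
  shows "minimal_submanifold (UNIV :: ('a \<times> 'b) set) (LO_cone f \<rho> U) \<longleftrightarrow>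
    (\<forall>r\<in>U.
       deriv (deriv \<rho>) r / (1 + (deriv \<rho> r)\<^sup>2)
       + (real n - real p) * deriv \<rho> r / r
       + real p * (deriv \<rho> r / r - l\<^sup>2 * \<rho> r / r\<^sup>2) / (1 + l\<^sup>2 * (\<rho> r)\<^sup>2 / r\<^sup>2) = 0)"
proof -
  obtain \<theta> where \<theta>: "0 < \<theta>" "\<theta> < pi / 2"
    and min: "minimal_submanifold (sphere 0 1) (LO_sphere f \<theta>)"
    using f unfolding LOMSE_def LOM_def by blast
  interpret constant_singular_value_map f l p
  proof unfold_locales
    show "smooth_map (sphere 0 1) (sphere 0 1) f" using f unfolding LOMSE_def LOM_def by blast
    show "l \<noteq> 0" using sv unfolding nonzero_singular_value_with_multiplicity_def by blast
    show "s = l" if "x \<in> sphere 0 1"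
      "singular_value (sphere_tangent x) (sphere_differential f x) s" "s \<noteq> 0" for x s
      using f sv that unfolding LOMSE_def nonzero_singular_value_with_multiplicity_def by blast
    show "singular_multiplicity (sphere_tangent x) (sphere_differential f x) l = p"
      if "x \<in> sphere 0 1" for x
      using sv that unfolding nonzero_singular_value_with_multiplicity_def by blast
  qed
  interpret rg: radial_graph ext \<rho> U by unfold_locales (fact U \<rho>)+
  have graph: "LO_cone f \<rho> U = (\<lambda>y. (y, rg.F y)) ` rg.domain"
    unfolding LO_cone_eq_graph[OF U(2)] rg.domain_def rg.F_def ..
  \<comment> \<open>Smoothness holds for every admissible profile, so minimality comes down to
    vanishing mean curvature.\<close>
  have "smooth_submanifold DIM('a) (LO_cone f \<rho> U)"
    unfolding graph by (rule smooth_submanifold_graph[OF rg.open_domain rg.smooth_F])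
  then have min_iff: "minimal_submanifold UNIV (LO_cone f \<rho> U) \<longleftrightarrow>
      (\<forall>q\<in>LO_cone f \<rho> U. mean_curvature UNIV (LO_cone f \<rho> U) q = 0)"
    unfolding minimal_submanifold_def by blast
  note curv = mean_curvature_LO_cone_zero_iff[OF \<theta> min dim_a U \<rho>]
  \<comment> \<open>The equation does not involve x, so one fixed direction suffices to read it off
    at every radius.\<close>
  obtain e :: 'a where e: "norm e = 1" using vector_choose_size[of 1] by auto
  have points: "q \<in> LO_cone f \<rho> U \<longleftrightarrow> (\<exists>x r. norm x = 1 \<and> r \<in> U \<and> q = (r *\<^sub>R x, \<rho> r *\<^sub>R ext x))" for q
    unfolding LO_cone_def using ext_sphere by fastforce
  show ?thesis
    unfolding min_iff
  proof (intro iffI ballI)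
    fix r assume h: "\<forall>q\<in>LO_cone f \<rho> U. mean_curvature UNIV (LO_cone f \<rho> U) q = 0" and r: "r \<in> U"
    have "(r *\<^sub>R e, \<rho> r *\<^sub>R ext e) \<in> LO_cone f \<rho> U" unfolding points using e r by blast
    then show "deriv (deriv \<rho>) r / (1 + (deriv \<rho> r)\<^sup>2)
       + (real n - real p) * deriv \<rho> r / r
       + real p * (deriv \<rho> r / r - l\<^sup>2 * \<rho> r / r\<^sup>2) / (1 + l\<^sup>2 * (\<rho> r)\<^sup>2 / r\<^sup>2) = 0"
      using h curv[OF e r] by blast
  next
    fix q assume ode: "\<forall>r\<in>U. deriv (deriv \<rho>) r / (1 + (deriv \<rho> r)\<^sup>2)
       + (real n - real p) * deriv \<rho> r / r
       + real p * (deriv \<rho> r / r - l\<^sup>2 * \<rho> r / r\<^sup>2) / (1 + l\<^sup>2 * (\<rho> r)\<^sup>2 / r\<^sup>2) = 0"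
      and "q \<in> LO_cone f \<rho> U"
    then obtain x r where "norm x = 1" "r \<in> U" "q = (r *\<^sub>R x, \<rho> r *\<^sub>R ext x)"
      unfolding points by blast
    then show "mean_curvature UNIV (LO_cone f \<rho> U) q = 0" using curv ode by blast
  qed
qed

end
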